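(* Let $p\in(0,1)$ be a constant (not depending on $n$). There exists an $\varepsilon>0$ such that, with high probability, the maximum size of an induced forest in the binomial random graph $G(n,p)$ equals either $\left\lfloor 2\log_{1/(1-p)}(enp)+2+\varepsilon\right\rfloor$ or $\left\lfloor 2\log_{1/(1-p)}(enp)+3+\varepsilon\right\rfloor$.
   Context: $G(n,p)$ is the random graph on vertex set $\{1,\ldots,n\}$ in which every pair of distinct vertices is adjacent with probability $p$ independently of all other pairs. A subgraph $H$ of a graph $G$ is induced if any two vertices of $H$ are adjacent in $H$ if and only if they are adjacent in $G$. A forest is an acyclic graph (not necessarily connected). The size of a graph is its number of vertices. "With high probability" means with probability tending to $1$ as $n\to\infty$. Here $e$ is the base of the natural logarithm and $\log_{1/(1-p)}$ is the logarithm to base $1/(1-p)$. *)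

theory Defs
  imports "HOL-Probability.Probability"
begin

text \<open>
  Undirected graphs are pairs of a vertex set and an edge set, an edge being the set of its two
  end points.
\<close>

type_synonym 'a graph = "'a set \<times> 'a set set"

abbreviation verts :: "'a graph \<Rightarrow> 'a set" where "verts \<equiv> fst"
abbreviation edges :: "'a graph \<Rightarrow> 'a set set" where "edges \<equiv> snd"

definition vertex_pairs :: "'a set \<Rightarrow> 'a set set" where
  "vertex_pairs V = {e. e \<subseteq> V \<and> card e = 2}"

definition simple_graph :: "'a graph \<Rightarrow> bool" where
  "simple_graph G \<longleftrightarrow> finite (verts G) \<and> edges G \<subseteq> vertex_pairs (verts G)"

definition adjacent :: "'a graph \<Rightarrow> 'a \<Rightarrow> 'a \<Rightarrow> bool" where
  "adjacent G u v \<longleftrightarrow> {u, v} \<in> edges G"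

definition subgraph :: "'a graph \<Rightarrow> 'a graph \<Rightarrow> bool" where
  "subgraph H G \<longleftrightarrow> simple_graph H \<and> verts H \<subseteq> verts G \<and> edges H \<subseteq> edges G"

definition induced_subgraph :: "'a graph \<Rightarrow> 'a graph \<Rightarrow> bool" where
  "induced_subgraph H G \<longleftrightarrow>
     subgraph H G \<and> (\<forall>u\<in>verts H. \<forall>v\<in>verts H. adjacent H u v \<longleftrightarrow> adjacent G u v)"

text \<open>
  A cycle is the list of its (at least three, pairwise distinct) vertices in cyclic order.
\<close>

definition is_cycle :: "'a graph \<Rightarrow> 'a list \<Rightarrow> bool" where
  "is_cycle G c \<longleftrightarrow> 3 \<le> length c \<and> distinct c \<and> set c \<subseteq> verts G \<and>
     (\<forall>i<length c. adjacent G (c ! i) (c ! (Suc i mod length c)))"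

definition forest :: "'a graph \<Rightarrow> bool" where
  "forest G \<longleftrightarrow> simple_graph G \<and> (\<nexists>c. is_cycle G c)"

definition graph_size :: "'a graph \<Rightarrow> nat" where
  "graph_size G = card (verts G)"

definition induced_forest_sizes :: "'a graph \<Rightarrow> nat set" where
  "induced_forest_sizes G = {graph_size F | F. induced_subgraph F G \<and> forest F}"

definition max_induced_forest_size :: "'a graph \<Rightarrow> nat" where
  "max_induced_forest_size G = Max (induced_forest_sizes G)"

text \<open>The maximum is taken over a finite nonempty set, so it is attained.\<close>

lemma finite_induced_forest_sizes:
  assumes "finite (verts G)"
  shows "finite (induced_forest_sizes G)"
proof (rule finite_subset)
  show "induced_forest_sizes G \<subseteq> {..card (verts G)}"
    using assms
    by (auto simp: induced_forest_sizes_def induced_subgraph_def subgraph_def graph_size_def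
        intro: card_mono)
qed simp

lemma induced_forest_sizes_nonempty: "induced_forest_sizes G \<noteq> {}"
proof -
  have "induced_subgraph ({}, {}) G" "forest ({}, {} :: 'a set set)"
    by (auto simp: induced_subgraph_def subgraph_def simple_graph_def forest_def is_cycle_def)
  then show ?thesis
    unfolding induced_forest_sizes_def by blast
qed

text \<open>
  The binomial random graph on \<open>{1..n}\<close>: an independent Bernoulli variable for each
  unordered pair of distinct vertices decides whether that pair is an edge.
\<close>

definition binomial_random_graph :: "nat \<Rightarrow> real \<Rightarrow> nat graph pmf" where
  "binomial_random_graph n p =
     map_pmf (\<lambda>f. ({1..n}, {e \<in> vertex_pairs {1..n}. f e}))
       (Pi_pmf (vertex_pairs {1..n}) False (\<lambda>_. bernoulli_pmf p))"

lemma simple_graph_binomial_random_graph: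
  assumes "G \<in> set_pmf (binomial_random_graph n p)"
  shows "simple_graph G" and "verts G = {1..n}"
  using assms by (auto simp: binomial_random_graph_def simple_graph_def)

definition with_high_probability :: "(nat \<Rightarrow> 'a pmf) \<Rightarrow> (nat \<Rightarrow> 'a \<Rightarrow> bool) \<Rightarrow> bool" where
  "with_high_probability M P \<longleftrightarrow>
     (\<lambda>n. measure_pmf.prob (M n) {x. P n x}) \<longlonglongrightarrow> 1"

end

theory Submission
  imports Defs "HOL-Real_Asymp.Real_Asymp"
begin

text \<open>
  Put \<open>q = 1 - p\<close>, \<open>\<theta> = p / q\<close> and let \<open>x\<close> be twice the logarithm of \<open>exp 1 * n * p\<close> to base
  \<open>1 / q\<close>, so that \<open>q powr (x / 2) * (exp 1 * n * p) = 1\<close>. There are \<open>k ^ k\<close> labelled forests on \<open>k\<close>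
  vertices up to factors that do not matter here, most of them with \<open>k - O(1)\<close> edges. The expected
  number of induced forests on \<open>k\<close> vertices is therefore about
  \<open>(n choose k) * (k * \<theta>) ^ k * q ^ (k choose 2)\<close>. By Stirling's formula this is
  \<open>(exp 1 * n * \<theta> * q powr ((k - 1) / 2)) ^ k = (q powr ((k - 3 - x) / 2)) ^ k\<close> up to such factors.
  The threshold for \<open>k\<close> is thus at \<open>x + 3\<close>, and a bounded distance from it already makes the
  expectation exponentially small or exponentially large in \<open>k\<close>. With \<open>\<epsilon> = 1 / 2\<close> the sizes
  \<open>\<lfloor>x + 5 / 2\<rfloor>\<close> and \<open>\<lfloor>x + 5 / 2\<rfloor> + 2\<close> lie on different sides at distance at least \<open>1 / 2\<close>, which
  leaves two possible values for the maximum.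

  The upper bound is the first moment method. A forest can be oriented towards roots, so it is
  given by a parent function (\<open>forest_parent_function\<close>), and the sum of \<open>\<theta>\<close> to the number of edges
  over all parent functions factorises to at most \<open>(1 + k * \<theta>) ^ k\<close> (\<open>first_moment_bound\<close>).

  The lower bound is the second moment method, applied to a family of forests of bounded
  degree that is rich enough for its expectation to grow nearly as fast as that of all forests. Such
  a family consists of the forests built of layers of constant size \<open>s\<close> in which each vertex chooses
  a parent in the previous layer. Each layer contributes \<open>s ^ s / fact s\<close>, which is nearly \<open>exp s\<close>,
  and this makes up for the difference between \<open>fact k\<close> and \<open>k ^ k\<close>
  (\<open>card_layered_forests\<close>, \<open>fact_le_power_exp\<close>).

  A bound \<open>\<Delta>\<close> on the degrees makes the variance easy. Let \<open>S\<close> and \<open>S'\<close> be two \<open>k\<close>-sets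
  with \<open>l\<close> common vertices. If \<open>l\<close> is at most \<open>3 * k / 4\<close>, knowing the edges on the common vertices gains at most the factor
  \<open>p ^ (- \<Delta> * l) * q powr (- (l choose 2))\<close>, which is far less than the factor \<open>(n / k\<^sup>2) ^ l\<close> lost in
  the choice of \<open>S'\<close> (\<open>extension_prob_small_overlap\<close>). If \<open>S'\<close> has few new vertices, say \<open>r\<close>, they
  touch at most \<open>\<Delta> * r\<close> edges, so there are few ways to complete the known part, while most of
  at least \<open>3 / 4 * k * r\<close> further pairs have to be non-edges; this outweighs the \<open>(k * n) ^ r\<close> choices of \<open>S'\<close>
  (\<open>extension_prob_large_overlap\<close>). The variance is thus negligible against the square of the mean
  (\<open>prob_no_hit_le\<close>).
\<close>

section \<open>Edge patterns in the random graph\<close>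

lemma finite_vertex_pairs: "finite V \<Longrightarrow> finite (vertex_pairs V)"
  by (rule finite_subset[of _ "Pow V"]) (auto simp: vertex_pairs_def)

lemma card_vertex_pairs: "finite V \<Longrightarrow> card (vertex_pairs V) = card V choose 2"
  unfolding vertex_pairs_def by (rule n_subsets)

lemma vertex_pairs_mono: "S \<subseteq> V \<Longrightarrow> vertex_pairs S \<subseteq> vertex_pairs V"
  by (auto simp: vertex_pairs_def)

lemma vertex_pairs_Int: "vertex_pairs S \<inter> vertex_pairs T = vertex_pairs (S \<inter> T)"
  by (auto simp: vertex_pairs_def)

text \<open>The probability that the pairs in \<open>Q\<close> which are edges are exactly those in \<open>H \<subseteq> Q\<close>.\<close>
definition pattern_prob :: "real \<Rightarrow> 'a set \<Rightarrow> 'a set \<Rightarrow> real" where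
  "pattern_prob p Q H = p ^ card H * (1 - p) ^ (card Q - card H)"

lemma pattern_prob_nonneg: "0 \<le> p \<Longrightarrow> p \<le> 1 \<Longrightarrow> 0 \<le> pattern_prob p Q H"
  by (simp add: pattern_prob_def)

lemma prob_edge_pattern:
  assumes "0 \<le> p" "p \<le> 1" and Q: "Q \<subseteq> vertex_pairs {1..n}" and H: "H \<subseteq> Q"
  shows "measure_pmf.prob (binomial_random_graph n p) {G. edges G \<inter> Q = H} = pattern_prob p Q H"
proof -
  let ?V = "vertex_pairs {1..n}"
  define B where "B = (\<lambda>e. if e \<in> Q then {b. b = (e \<in> H)} else UNIV)"
  have fin: "finite ?V" by (simp add: finite_vertex_pairs)
  have finQ: "finite Q" using Q fin finite_subset by blast
  have "measure_pmf.prob (binomial_random_graph n p) {G. edges G \<inter> Q = H}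
      = measure_pmf.prob (Pi_pmf ?V False (\<lambda>_. bernoulli_pmf p)) (Pi ?V B)"
    unfolding binomial_random_graph_def measure_map_pmf
  proof (rule arg_cong[where f = "measure_pmf.prob _"], safe, goal_cases)
    case (1 f e)
    then show ?case using Q H by (auto simp: B_def)
  next
    case (2 f)
    then have f: "f e = (e \<in> H)" if "e \<in> Q" for e
      using that Q by (auto simp: B_def Pi_def)
    show ?case using f Q H by auto
  qed
  also have "\<dots> = (\<Prod>e\<in>?V. measure_pmf.prob (bernoulli_pmf p) (B e))"
    by (rule measure_Pi_pmf_Pi[OF fin])
  also have "\<dots> = (\<Prod>e\<in>Q. measure_pmf.prob (bernoulli_pmf p) (B e))"
    using Q fin by (intro prod.mono_neutral_right) (auto simp: B_def)
  also have "\<dots> = (\<Prod>e\<in>Q. if e \<in> H then p else 1 - p)"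
  proof (intro prod.cong refl)
    fix e assume "e \<in> Q"
    then have "B e = {e \<in> H}" by (auto simp: B_def)
    then show "measure_pmf.prob (bernoulli_pmf p) (B e) = (if e \<in> H then p else 1 - p)"
      using assms(1,2) by (simp add: measure_pmf_single)
  qed
  also have "\<dots> = p ^ card H * (1 - p) ^ card (Q - H)"
    using finQ H by (simp add: prod.If_cases Int_absorb1 Diff_eq[symmetric] flip: Diff_eq)
  also have "card (Q - H) = card Q - card H"
    using finQ H by (meson card_Diff_subset finite_subset)
  finally show ?thesis by (simp add: pattern_prob_def)
qed

text \<open>The edges inside disjoint sets of pairs are independent. Conditioning on the graph seen on one
  vertex set is always carried out through this factorisation.\<close>
lemma pattern_prob_disjoint_union:
  assumes "finite Q" "finite Q'" "Q \<inter> Q' = {}" "H \<subseteq> Q" "H' \<subseteq> Q'"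
  shows "pattern_prob p (Q \<union> Q') (H \<union> H') = pattern_prob p Q H * pattern_prob p Q' H'"
proof -
  have fin: "finite H" "finite H'" using assms by (auto dest: finite_subset)
  have c: "card (H \<union> H') = card H + card H'" "card (Q \<union> Q') = card Q + card Q'"
    using assms fin by (auto intro!: card_Un_disjoint)
  have le: "card H \<le> card Q" "card H' \<le> card Q'" using assms by (auto intro: card_mono)
  have "card Q + card Q' - (card H + card H') = (card Q - card H) + (card Q' - card H')"
    using le by simp
  then show ?thesis unfolding pattern_prob_def c by (simp add: power_add)
qed

section \<open>The second moment method\<close>

text \<open>Chebyshev's inequality for the number \<open>X\<close> of events that occur: where none of them occurs,
  \<open>(X - \<mu>)\<^sup>2\<close> equals \<open>\<mu>\<^sup>2\<close>, so the probability of this is at most the variance of \<open>X\<close> over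
  \<open>\<mu>\<^sup>2\<close>.\<close>
lemma second_moment_bound:
  fixes M :: "'b pmf" and A :: "'i \<Rightarrow> 'b set" and \<eta> :: real
  assumes fin: "finite I" and mu: "\<mu> = (\<Sum>i\<in>I. measure_pmf.prob M (A i))" "0 < \<mu>"
    and second: "(\<Sum>i\<in>I. \<Sum>j\<in>I. measure_pmf.prob M (A i \<inter> A j)) \<le> (1 + \<eta>) * \<mu>\<^sup>2"
  shows "measure_pmf.prob M (- (\<Union>i\<in>I. A i)) \<le> \<eta>"
proof -
  define X where "X = (\<lambda>x. \<Sum>i\<in>I. indicator (A i) x :: real)"
  have int_ind: "integrable (measure_pmf M) (\<lambda>x. indicator B x :: real)" for B
    by (intro measure_pmf.integrable_const_bound[where B=1]) auto
  have intX: "integrable (measure_pmf M) X"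
    unfolding X_def by (intro Bochner_Integration.integrable_sum int_ind)
  have X2: "(X x)\<^sup>2 = (\<Sum>i\<in>I. \<Sum>j\<in>I. indicator (A i \<inter> A j) x)" for x
    unfolding X_def power2_eq_square sum_product by (simp add: indicator_inter_arith)
  have intX2: "integrable (measure_pmf M) (\<lambda>x. (X x)\<^sup>2)"
    unfolding X2 by (intro Bochner_Integration.integrable_sum int_ind)
  have EX: "measure_pmf.expectation M X = \<mu>"
    unfolding X_def mu by (subst Bochner_Integration.integral_sum) (auto intro: int_ind)
  have EX2: "measure_pmf.expectation M (\<lambda>x. (X x)\<^sup>2) \<le> (1 + \<eta>) * \<mu>\<^sup>2"
    unfolding X2 using second
    by (subst Bochner_Integration.integral_sum) (auto intro!: int_ind simp: Bochner_Integration.integral_sum int_ind)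
  have int3: "integrable (measure_pmf M) (\<lambda>x. (X x - \<mu>)\<^sup>2)"
    unfolding power2_diff using intX intX2 by auto
  have "measure_pmf.prob M (- (\<Union>i\<in>I. A i)) * \<mu>\<^sup>2
      = measure_pmf.expectation M (\<lambda>x. indicator (- (\<Union>i\<in>I. A i)) x * \<mu>\<^sup>2)"
    by simp
  also have "\<dots> \<le> measure_pmf.expectation M (\<lambda>x. (X x - \<mu>)\<^sup>2)"
  proof (rule integral_mono)
    show "integrable (measure_pmf M) (\<lambda>x. indicator (- (\<Union>i\<in>I. A i)) x * \<mu>\<^sup>2)"
      by (intro integrable_mult_left int_ind)
    fix x
    show "indicator (- (\<Union>i\<in>I. A i)) x * \<mu>\<^sup>2 \<le> (X x - \<mu>)\<^sup>2"
      by (cases "x \<in> (\<Union>i\<in>I. A i)") (auto simp: X_def indicator_def)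
  qed (rule int3)
  also have "\<dots> = measure_pmf.expectation M (\<lambda>x. (X x)\<^sup>2) - \<mu>\<^sup>2"
  proof -
    have "measure_pmf.expectation M (\<lambda>x. (X x - \<mu>)\<^sup>2)
        = measure_pmf.expectation M (\<lambda>x. (X x)\<^sup>2 + \<mu>\<^sup>2 - (2 * \<mu>) * X x)"
      by (simp add: power2_diff mult_ac)
    also have "\<dots> = measure_pmf.expectation M (\<lambda>x. (X x)\<^sup>2) + \<mu>\<^sup>2 - (2 * \<mu>) * \<mu>"
      using intX intX2 EX by simp
    finally show ?thesis by (simp add: power2_eq_square)
  qed
  also have "\<dots> \<le> \<eta> * \<mu>\<^sup>2" using EX2 by (simp add: algebra_simps)
  finally show ?thesis using mu(2) by simp
qed

section \<open>Forests, parent functions and induced subgraphs\<close>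

lemma forest_restrict:
  assumes "forest (V, E)" "S \<subseteq> V"
  shows "forest (S, E \<inter> vertex_pairs S)"
proof -
  have "is_cycle (V, E) c" if "is_cycle (S, E \<inter> vertex_pairs S) c" for c
    using that assms(2) by (auto simp: is_cycle_def adjacent_def)
  then show ?thesis
    using assms finite_subset[of S V] by (auto simp: forest_def simple_graph_def)
qed

text \<open>The first vertex of a longest path has all its neighbours on that path. If it had two of them,
  the farther one would close a cycle.\<close>
lemma forest_has_leaf:
  assumes F: "forest (S, F)" and "S \<noteq> {}"
  shows "\<exists>v\<in>S. \<forall>u w. {v, u} \<in> F \<longrightarrow> {v, w} \<in> F \<longrightarrow> u = w"
proof (rule ccontr)
  assume "\<not> ?thesis"
  then have two: "\<exists>u w. {v, u} \<in> F \<and> {v, w} \<in> F \<and> u \<noteq> w" if "v \<in> S" for v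
    using that by blast
  have fin: "finite S" and FS: "F \<subseteq> vertex_pairs S" using F by (auto simp: forest_def simple_graph_def)
  define is_path where "is_path = (\<lambda>xs. xs \<noteq> [] \<and> distinct xs \<and> set xs \<subseteq> S \<and>
    (\<forall>i. Suc i < length xs \<longrightarrow> {xs ! i, xs ! Suc i} \<in> F))"
  obtain v0 where "v0 \<in> S" using \<open>S \<noteq> {}\<close> by blast
  then have "is_path [v0]" by (auto simp: is_path_def)
  moreover have "length xs \<le> card S" if "is_path xs" for xs
    using that fin by (metis is_path_def card_mono distinct_card)
  ultimately obtain xs where xs: "is_path xs" and max: "\<And>ys. is_path ys \<Longrightarrow> length ys \<le> length xs"
    using ex_has_greatest_nat[of is_path "[v0]" length "Suc (card S)"] by (metis le_imp_less_Suc)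
  define v where "v = xs ! 0"
  have vS: "v \<in> S" using xs by (auto simp: is_path_def v_def)
  have nbr: "\<exists>i. 0 < i \<and> i < length xs \<and> xs ! i = u" if u: "{v, u} \<in> F" for u
  proof -
    have uS: "u \<in> S" "u \<noteq> v" using u FS by (auto simp: vertex_pairs_def)
    have "u \<in> set xs"
    proof (rule ccontr)
      assume "u \<notin> set xs"
      then have "is_path (u # xs)"
        using xs uS u by (auto simp: is_path_def nth_Cons insert_commute v_def split: nat.split)
      then show False using max[of "u # xs"] by simp
    qed
    then obtain i where "i < length xs" "xs ! i = u" by (auto simp: in_set_conv_nth)
    then show ?thesis using uS(2) by (metis gr0I v_def)
  qed
  obtain u w where uw: "{v, u} \<in> F" "{v, w} \<in> F" "u \<noteq> w" using two[OF vS] by blast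
  obtain i j where ij: "0 < i" "i < length xs" "xs ! i = u" "0 < j" "j < length xs" "xs ! j = w"
    using nbr[OF uw(1)] nbr[OF uw(2)] by auto
  have ne: "i \<noteq> j" using ij uw by auto
  \<comment> \<open>One of two different positive positions is at least \<open>2\<close>, so the cycle has length at least \<open>3\<close>.\<close>
  define m where "m = max i j"
  have m: "2 \<le> m" "m < length xs" "{v, xs ! m} \<in> F"
    using ij uw ne by (simp_all add: m_def max_def)
  have "is_cycle (S, F) (take (Suc m) xs)"
    unfolding is_cycle_def
  proof (intro conjI allI impI)
    show "set (take (Suc m) xs) \<subseteq> verts (S, F)"
      using xs set_take_subset[of "Suc m" xs] by (auto simp: is_path_def)
    fix l assume l: "l < length (take (Suc m) xs)"
    show "adjacent (S, F) (take (Suc m) xs ! l) (take (Suc m) xs ! (Suc l mod length (take (Suc m) xs)))"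
    proof (cases "l = m")
      case True
      then show ?thesis using m by (auto simp: adjacent_def v_def insert_commute)
    next
      case False
      then have "l < m" using l by auto
      then show ?thesis using m xs by (auto simp: adjacent_def is_path_def)
    qed
  qed (use m xs in \<open>auto simp: is_path_def\<close>)
  then show False using F by (auto simp: forest_def)
qed

text \<open>A function \<open>f\<close> that sends every vertex to its parent describes a rooted forest; a root is its own
  parent and contributes no edge.\<close>
definition parent_edges :: "'a set \<Rightarrow> ('a \<Rightarrow> 'a) \<Rightarrow> 'a set set" where
  "parent_edges S f = (\<lambda>v. {v, f v}) ` {v \<in> S. f v \<noteq> v}"

text \<open>Stripping off leaves one by one orients every forest towards roots. The number of edges then
  equals the number of non-roots, which is what makes the sum over forests factorise over the
  vertices in the first moment.\<close>
lemma forest_parent_function: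
  assumes "forest (S, F)"
  shows "\<exists>f \<in> S \<rightarrow>\<^sub>E S. F = parent_edges S f \<and> card F = card {v \<in> S. f v \<noteq> v}"
proof -
  have "finite S" using assms by (simp add: forest_def simple_graph_def)
  then show ?thesis using assms
  proof (induction S arbitrary: F rule: finite_psubset_induct)
    case (psubset S)
    have FS: "F \<subseteq> vertex_pairs S" using psubset.prems by (auto simp: forest_def simple_graph_def)
    show ?case
    proof (cases "S = {}")
      case True
      then have "F = {}" using FS by (auto simp: vertex_pairs_def)
      then show ?thesis using True by (auto simp: parent_edges_def)
    next
      case False
      obtain v where v: "v \<in> S" and only: "\<forall>u w. {v, u} \<in> F \<longrightarrow> {v, w} \<in> F \<longrightarrow> u = w"
        using forest_has_leaf[OF psubset.prems False] by (elim bexE)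
      have leaf: "u = w" if "{v, u} \<in> F" "{v, w} \<in> F" for u w
        using only that by (elim allE impE)
      define S' where "S' = S - {v}"
      define F' where "F' = F \<inter> vertex_pairs S'"
      have "forest (S', F')" unfolding F'_def S'_def by (rule forest_restrict[OF psubset.prems]) auto
      then obtain f' where f': "f' \<in> S' \<rightarrow>\<^sub>E S'" "F' = parent_edges S' f'"
        "card F' = card {w \<in> S'. f' w \<noteq> w}"
        using psubset.IH[of S' F'] v by (auto simp: S'_def)
      have finF: "finite F" using FS finite_vertex_pairs[OF psubset.hyps] finite_subset by blast
      have edge: "\<exists>u\<in>S'. e = {v, u}" if "e \<in> F" "e \<notin> F'" for e
      proof -
        have e: "e \<subseteq> S" "card e = 2" using that FS by (auto simp: vertex_pairs_def)
        then have "v \<in> e" using that unfolding F'_def S'_def vertex_pairs_def by auto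
        then obtain u where "e = {v, u}" "u \<noteq> v"
          using e by (metis card_2_iff doubleton_eq_iff insertE singletonD)
        then show ?thesis using e by (auto simp: S'_def)
      qed
      show ?thesis
      proof (cases "F = F'")
        case True
        define f where "f = f'(v := v)"
        have dom: "{w \<in> S. f w \<noteq> w} = {w \<in> S'. f' w \<noteq> w}" by (auto simp: f_def S'_def)
        have "parent_edges S f = parent_edges S' f'"
          unfolding parent_edges_def dom by (intro image_cong) (auto simp: f_def S'_def)
        then have pe: "F = parent_edges S f" using True f' by simp
        have cF: "card F = card {w \<in> S. f w \<noteq> w}" unfolding dom True by (rule f'(3))
        have fS: "f \<in> S \<rightarrow>\<^sub>E S" using f'(1) v by (auto simp: f_def S'_def PiE_def extensional_def Pi_def)
        show ?thesis by (intro bexI[of _ f] conjI pe cF fS)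
      next
        case False
        then obtain e where "e \<in> F" "e \<notin> F'" by (auto simp: F'_def)
        then obtain u where u: "u \<in> S'" "{v, u} \<in> F" using edge[of e] by auto
        have new: "{v, u} \<notin> F'" by (auto simp: F'_def S'_def vertex_pairs_def)
        have F: "F = insert {v, u} F'"
        proof (intro equalityI subsetI)
          fix e assume e: "e \<in> F"
          show "e \<in> insert {v, u} F'"
          proof (cases "e \<in> F'")
            case False
            then obtain u' where "e = {v, u'}" using edge[OF e] by blast
            then show ?thesis using leaf[of u u'] u e by simp
          qed simp
        qed (use u in \<open>auto simp: F'_def\<close>)
        define f where "f = f'(v := u)"
        have dom: "{w \<in> S. f w \<noteq> w} = insert v {w \<in> S'. f' w \<noteq> w}"
          using u v by (auto simp: f_def S'_def)
        have "parent_edges S f = insert {v, u} ((\<lambda>w. {w, f w}) ` {w \<in> S'. f' w \<noteq> w})"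
          unfolding parent_edges_def dom by (simp add: f_def)
        also have "(\<lambda>w. {w, f w}) ` {w \<in> S'. f' w \<noteq> w} = parent_edges S' f'"
          unfolding parent_edges_def by (intro image_cong) (auto simp: f_def S'_def)
        finally have pe: "F = parent_edges S f" using F f' by simp
        have cF: "card F = card {w \<in> S. f w \<noteq> w}"
        proof -
          have "card F = Suc (card F')" using F new finF by simp
          moreover have "card {w \<in> S. f w \<noteq> w} = Suc (card {w \<in> S'. f' w \<noteq> w})"
            unfolding dom using psubset.hyps by (subst card_insert_disjoint) (auto simp: S'_def)
          ultimately show ?thesis using f' by simp
        qed
        have fS: "f \<in> S \<rightarrow>\<^sub>E S"
          using f'(1) v u by (auto simp: f_def S'_def PiE_def extensional_def Pi_def)
        show ?thesis by (intro bexI[of _ f] conjI pe cF fS)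
      qed
    qed
  qed
qed

text \<open>In a cycle, a vertex of largest rank would have two different neighbours of smaller rank.\<close>
lemma forest_if_ranked:
  fixes h :: "'a \<Rightarrow> nat"
  assumes fin: "finite S" and FS: "F \<subseteq> vertex_pairs S"
    and rank: "\<And>u v. {u, v} \<in> F \<Longrightarrow> h u \<noteq> h v"
    and parent: "\<And>v u w. {v, u} \<in> F \<Longrightarrow> {v, w} \<in> F \<Longrightarrow> h u < h v \<Longrightarrow> h w < h v \<Longrightarrow> u = w"
  shows "forest (S, F)"
proof -
  have False if c: "is_cycle (S, F) c" for c
  proof -
    let ?L = "length c"
    have L: "3 \<le> ?L" "distinct c" and adj: "\<And>i. i < ?L \<Longrightarrow> {c ! i, c ! (Suc i mod ?L)} \<in> F"
      using c by (auto simp: is_cycle_def adjacent_def)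
    have "Max ((\<lambda>i. h (c ! i)) ` {..<?L}) \<in> (\<lambda>i. h (c ! i)) ` {..<?L}"
      using L by (intro Max_in) (auto simp: lessThan_empty_iff)
    then obtain i where i: "i < ?L" and "h (c ! i) = Max ((\<lambda>i. h (c ! i)) ` {..<?L})" by auto
    then have max: "h (c ! j) \<le> h (c ! i)" if "j < ?L" for j
      using that by (auto intro!: Max_ge)
    define a where "a = Suc i mod ?L"
    define b where "b = (if i = 0 then ?L - 1 else i - 1)"
    have ab: "a < ?L" "b < ?L" using L i by (auto simp: a_def b_def intro!: mod_less_divisor)
    have bi: "Suc b mod ?L = i" using L i by (auto simp: b_def)
    have "a \<noteq> b"
    proof (cases "Suc i = ?L")
      case True then show ?thesis using L by (auto simp: a_def b_def)
    next
      case False then have "a = Suc i" using i by (auto simp: a_def)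
      then show ?thesis using L by (auto simp: b_def)
    qed
    then have "c ! a \<noteq> c ! b" using L ab by (simp add: nth_eq_iff_index_eq)
    moreover have ia: "{c ! i, c ! a} \<in> F" using adj[OF i] by (simp add: a_def)
    moreover have ib: "{c ! i, c ! b} \<in> F" using adj[OF ab(2)] bi by (simp add: insert_commute)
    moreover have "h (c ! a) < h (c ! i)" using rank[OF ia] max[OF ab(1)] by linarith
    moreover have "h (c ! b) < h (c ! i)" using rank[OF ib] max[OF ab(2)] by linarith
    ultimately show False using parent by blast
  qed
  then show ?thesis using fin FS by (auto simp: forest_def simple_graph_def)
qed


text \<open>Since forests are closed under passing to induced subgraphs, the maximum is at least \<open>k\<close> as soon
  as some induced forest has exactly \<open>k\<close> vertices; both tails reduce to a single size.\<close>
lemma max_induced_forest_size_ge_iff: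
  assumes G: "simple_graph G"
  shows "k \<le> max_induced_forest_size G \<longleftrightarrow>
    (\<exists>S\<subseteq>verts G. card S = k \<and> forest (S, edges G \<inter> vertex_pairs S))"
proof
  assume "k \<le> max_induced_forest_size G"
  then have "\<exists>a\<in>induced_forest_sizes G. k \<le> a"
    using Max_ge_iff[of "induced_forest_sizes G" k] G
      finite_induced_forest_sizes[of G] induced_forest_sizes_nonempty[of G]
    by (simp add: max_induced_forest_size_def simple_graph_def)
  then obtain H where H: "induced_subgraph H G" "forest H" "k \<le> card (verts H)"
    by (auto simp: induced_forest_sizes_def graph_size_def)
  obtain S where S: "S \<subseteq> verts H" "card S = k"
    using obtain_subset_with_card_n[OF H(3)] by metis
  have HG: "verts H \<subseteq> verts G" "\<And>u v. u \<in> verts H \<Longrightarrow> v \<in> verts H \<Longrightarrow> {u, v} \<in> edges H \<longleftrightarrow> {u, v} \<in> edges G"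
    using H(1) by (auto simp: induced_subgraph_def subgraph_def adjacent_def)
  have "e \<in> edges H \<longleftrightarrow> e \<in> edges G" if "e \<in> vertex_pairs S" for e
  proof -
    have "e \<subseteq> verts H" "card e = 2" using that S(1) by (auto simp: vertex_pairs_def)
    then obtain u v where e: "e = {u, v}" "u \<in> verts H" "v \<in> verts H"
      by (metis card_2_iff insert_subset)
    then show ?thesis using HG(2) by simp
  qed
  then have "edges H \<inter> vertex_pairs S = edges G \<inter> vertex_pairs S" by blast
  moreover have "forest (S, edges H \<inter> vertex_pairs S)"
    using forest_restrict[of "verts H" "edges H" S] H S by simp
  ultimately show "\<exists>S\<subseteq>verts G. card S = k \<and> forest (S, edges G \<inter> vertex_pairs S)"
    using S HG(1) by (intro exI[of _ S]) simp
next
  assume "\<exists>S\<subseteq>verts G. card S = k \<and> forest (S, edges G \<inter> vertex_pairs S)"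
  then obtain S where S: "S \<subseteq> verts G" "card S = k" and f: "forest (S, edges G \<inter> vertex_pairs S)" by blast
  have "{u, v} \<in> vertex_pairs S" if "{u, v} \<in> edges G" "u \<in> S" "v \<in> S" for u v
    using that G unfolding simple_graph_def vertex_pairs_def by blast
  then have "induced_subgraph (S, edges G \<inter> vertex_pairs S) G"
    using S f by (auto simp: induced_subgraph_def subgraph_def forest_def adjacent_def)
  then have "graph_size (S, edges G \<inter> vertex_pairs S) \<in> induced_forest_sizes G"
    using f unfolding induced_forest_sizes_def by blast
  then have "k \<in> induced_forest_sizes G" using S by (simp add: graph_size_def)
  then show "k \<le> max_induced_forest_size G"
    unfolding max_induced_forest_size_def
    using finite_induced_forest_sizes[of G] G by (simp add: simple_graph_def)
qed

section \<open>Layered forests\<close>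

text \<open>Edge sets of forests on \<open>S\<close> built from a root layer \<open>R\<close> by adding \<open>M\<close> further layers of \<open>s\<close>
  vertices, every vertex of a layer being joined to one parent in the layer just before it. Vertices
  of \<open>S\<close> that end up in no layer are isolated, so that \<open>card S\<close> may be arbitrary. Layers of
  size \<open>s\<close> keep the degrees bounded, and for large \<open>s\<close> the number of these forests still comes close
  to the exponential growth rate of the number of all forests: see \<open>card_layered_forests\<close> and \<open>fact_le_power_exp\<close>.\<close>
fun layered_forests :: "nat \<Rightarrow> nat \<Rightarrow> 'a set \<Rightarrow> 'a set \<Rightarrow> 'a set set set" where
  "layered_forests s 0 S R = {{}}"
| "layered_forests s (Suc M) S R =
    (\<lambda>(T, g, F). (\<lambda>v. {v, g v}) ` T \<union> F) `
      (SIGMA T:{T. T \<subseteq> S - R \<and> card T = s}. (T \<rightarrow>\<^sub>E R) \<times> layered_forests s M (S - R) T)"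

lemma layered_forests_SucE:
  assumes "F \<in> layered_forests s (Suc M) S R"
  obtains T g F' where "T \<subseteq> S - R" "card T = s" "g \<in> T \<rightarrow> R" "F' \<in> layered_forests s M (S - R) T"
    "F = (\<lambda>v. {v, g v}) ` T \<union> F'"
  using assms by auto

lemma layered_forests_edges:
  "R \<subseteq> S \<Longrightarrow> F \<in> layered_forests s M S R \<Longrightarrow> F \<subseteq> vertex_pairs S"
proof (induction M arbitrary: S R F)
  case (Suc M)
  obtain T g F' where F: "T \<subseteq> S - R" "card T = s" "g \<in> T \<rightarrow> R"
    "F' \<in> layered_forests s M (S - R) T" "F = (\<lambda>v. {v, g v}) ` T \<union> F'"
    using Suc.prems(2) by (rule layered_forests_SucE)
  have "F' \<subseteq> vertex_pairs S"
    using Suc.IH[OF F(1,4)] vertex_pairs_mono[of "S - R" S] by auto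
  moreover have "{v, g v} \<in> vertex_pairs S" if "v \<in> T" for v
  proof -
    have "g v \<in> R" using that F(3) by auto
    then have "v \<noteq> g v" "v \<in> S" "g v \<in> S" using that F(1) Suc.prems(1) by auto
    then show ?thesis by (simp add: vertex_pairs_def)
  qed
  ultimately show ?case unfolding F(5) by blast
qed simp

lemma finite_layered_forests:
  assumes "finite S" "R \<subseteq> S"
  shows "finite (layered_forests s M S R)"
  using layered_forests_edges[OF assms(2)] finite_vertex_pairs[OF assms(1)]
  by (meson PowI finite_Pow_iff finite_subset subsetI)

lemma parent_edge_eq_iff:
  assumes "v \<notin> R" "w \<notin> R" "g v \<in> R" "g' w \<in> R"
  shows "{v, g v} = {w, g' w} \<longleftrightarrow> v = w \<and> g v = g' w"
  using assms by (auto simp: doubleton_eq_iff)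

lemma card_layered_forest:
  "finite S \<Longrightarrow> R \<subseteq> S \<Longrightarrow> F \<in> layered_forests s M S R \<Longrightarrow> card F = s * M"
proof (induction M arbitrary: S R F)
  case (Suc M)
  obtain T g F' where F: "T \<subseteq> S - R" "card T = s" "g \<in> T \<rightarrow> R"
    "F' \<in> layered_forests s M (S - R) T" "F = (\<lambda>v. {v, g v}) ` T \<union> F'"
    using Suc.prems(3) by (rule layered_forests_SucE)
  have finT: "finite T" using F(1) Suc.prems(1) finite_subset by blast
  have F': "F' \<subseteq> vertex_pairs (S - R)" using layered_forests_edges[OF F(1,4)] .
  have "inj_on (\<lambda>v. {v, g v}) T"
    by (rule inj_onI) (use F(1,3) in \<open>auto simp: doubleton_eq_iff\<close>)
  then have "card ((\<lambda>v. {v, g v}) ` T) = s" using F(2) by (simp add: card_image)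
  moreover have "card F' = s * M" using Suc.IH[OF _ F(1,4)] Suc.prems(1) by simp
  moreover have "(\<lambda>v. {v, g v}) ` T \<inter> F' = {}"
    using F' F(3) by (auto simp: vertex_pairs_def)
  moreover have "finite F'"
    using F' finite_vertex_pairs[of "S - R"] Suc.prems(1) finite_subset by blast
  ultimately show ?case unfolding F(5) using finT by (subst card_Un_disjoint) auto
qed simp

lemma layered_forest_degree:
  "finite S \<Longrightarrow> R \<subseteq> S \<Longrightarrow> F \<in> layered_forests s M S R \<Longrightarrow>
    card {e \<in> F. v \<in> e} \<le> s + (if v \<in> R then 0 else 1)"
proof (induction M arbitrary: S R F)
  case (Suc M)
  obtain T g F' where F: "T \<subseteq> S - R" "card T = s" "g \<in> T \<rightarrow> R"
    "F' \<in> layered_forests s M (S - R) T" "F = (\<lambda>v. {v, g v}) ` T \<union> F'"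
    using Suc.prems(3) by (rule layered_forests_SucE)
  have finT: "finite T" using F(1) Suc.prems(1) finite_subset by blast
  have F': "F' \<subseteq> vertex_pairs (S - R)" using layered_forests_edges[OF F(1,4)] .
  have finF': "finite F'"
    using F' finite_vertex_pairs[of "S - R"] Suc.prems(1) finite_subset by blast
  have IH: "card {e \<in> F'. v \<in> e} \<le> s + (if v \<in> T then 0 else 1)"
    using Suc.IH[OF _ F(1,4)] Suc.prems(1) by simp
  show ?case
  proof (cases "v \<in> R")
    case True
    have "{e \<in> F. v \<in> e} \<subseteq> (\<lambda>v. {v, g v}) ` T"
      using True F' unfolding F(5) by (auto simp: vertex_pairs_def)
    then have "card {e \<in> F. v \<in> e} \<le> card ((\<lambda>v. {v, g v}) ` T)"
      using finT by (intro card_mono) auto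
    also have "\<dots> \<le> s" using card_image_le[OF finT] F(2) by metis
    finally show ?thesis by simp
  next
    case False
    show ?thesis
    proof (cases "v \<in> T")
      case True
      have "{e \<in> F. v \<in> e} \<subseteq> insert {v, g v} {e \<in> F'. v \<in> e}"
        using False F(1,3) unfolding F(5) by auto
      then have "card {e \<in> F. v \<in> e} \<le> card (insert {v, g v} {e \<in> F'. v \<in> e})"
        using finF' by (intro card_mono) auto
      also have "\<dots> \<le> Suc (card {e \<in> F'. v \<in> e})" using finF' by (simp add: card_insert_if)
      finally show ?thesis using IH True False by simp
    next
      case nT: False
      have "{e \<in> F. v \<in> e} = {e \<in> F'. v \<in> e}"
        using False nT F(1,3) unfolding F(5) by auto
      then show ?thesis using IH False nT by simp
    qed
  qed
qed simp

text \<open>What the induction over the layers needs to know about layer numbers in order to exclude cycles.\<close>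
definition rooted_ranking :: "'a set \<Rightarrow> 'a set set \<Rightarrow> ('a \<Rightarrow> nat) \<Rightarrow> bool" where
  "rooted_ranking R F h \<longleftrightarrow> (\<forall>v\<in>R. h v = 0) \<and> (\<forall>u v. {u, v} \<in> F \<longrightarrow> h u \<noteq> h v) \<and>
    (\<forall>v u w. {v, u} \<in> F \<longrightarrow> {v, w} \<in> F \<longrightarrow> h u < h v \<longrightarrow> h w < h v \<longrightarrow> u = w)"

lemma rooted_rankingD:
  assumes "rooted_ranking R F h"
  shows "v \<in> R \<Longrightarrow> h v = 0"
    and "{u, v} \<in> F \<Longrightarrow> h u \<noteq> h v"
    and "{v, u} \<in> F \<Longrightarrow> {v, w} \<in> F \<Longrightarrow> h u < h v \<Longrightarrow> h w < h v \<Longrightarrow> u = w"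
  using assms unfolding rooted_ranking_def by (simp, simp, meson)

lemma layered_forest_rank:
  "R \<subseteq> S \<Longrightarrow> F \<in> layered_forests s M S R \<Longrightarrow> \<exists>h. rooted_ranking R F h"
proof (induction M arbitrary: S R F)
  case 0
  then have "F = {}" by simp
  then show ?case by (intro exI[of _ "\<lambda>_. 0"]) (simp add: rooted_ranking_def)
next
  case (Suc M)
  obtain T g F' where F: "T \<subseteq> S - R" "card T = s" "g \<in> T \<rightarrow> R"
    "F' \<in> layered_forests s M (S - R) T" "F = (\<lambda>v. {v, g v}) ` T \<union> F'"
    using Suc.prems(2) by (rule layered_forests_SucE)
  have F': "F' \<subseteq> vertex_pairs (S - R)" using layered_forests_edges[OF F(1,4)] .
  obtain h' where "rooted_ranking T F' h'" using Suc.IH[OF F(1,4)] by blast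
  note h' = rooted_rankingD[OF this]
  \<comment> \<open>Shift the layer numbers of the smaller forest up by one and put \<open>R\<close> below.\<close>
  define h where "h = (\<lambda>v. if v \<in> R then 0 else Suc (h' v))"
  have new: "{v, u} \<in> (\<lambda>v. {v, g v}) ` T \<longleftrightarrow> v \<in> T \<and> u = g v \<or> u \<in> T \<and> v = g u" for u v
    by (auto simp: doubleton_eq_iff)
  have old: "u \<notin> R \<and> v \<notin> R" if "{u, v} \<in> F'" for u v
    using that F' by (auto simp: vertex_pairs_def)
  \<comment> \<open>A downward edge leads from the second layer to the roots or lies in the smaller forest.\<close>
  have down: "v \<in> T \<and> u = g v \<or> {v, u} \<in> F' \<and> h' u < h' v" if "{v, u} \<in> F" "h u < h v" for u v
  proof (cases "{v, u} \<in> F'")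
    case True
    then show ?thesis using that(2) old[OF True] by (simp add: h_def)
  next
    case False
    then have "v \<in> T \<and> u = g v \<or> u \<in> T \<and> v = g u" using that(1) new[of v u] unfolding F(5) by simp
    moreover have "v \<notin> R" using that(2) by (auto simp: h_def)
    ultimately show ?thesis using F(3) by auto
  qed
  have "h v = 0" if "v \<in> R" for v using that by (simp add: h_def)
  moreover have "h u \<noteq> h v" if "{u, v} \<in> F" for u v
  proof (cases "{u, v} \<in> F'")
    case True
    then show ?thesis using h'(2)[OF True] old[OF True] by (simp add: h_def)
  next
    case False
    then have "u \<in> T \<and> v = g u \<or> v \<in> T \<and> u = g v" using that new[of u v] unfolding F(5) by simp
    then show ?thesis using F(1,3) by (auto simp: h_def)
  qed
  moreover have "u = w" if "{v, u} \<in> F" "{v, w} \<in> F" "h u < h v" "h w < h v" for u v w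
    using down[OF that(1,3)] down[OF that(2,4)] h'(1)[of v] h'(3)[of v u w] by auto
  ultimately have "rooted_ranking R F h" unfolding rooted_ranking_def by (intro conjI ballI allI impI)
  then show ?case by blast
qed

lemma layered_forest_is_forest:
  assumes "finite S" "R \<subseteq> S" "F \<in> layered_forests s M S R"
  shows "forest (S, F)"
proof -
  obtain h where h: "rooted_ranking R F h" using layered_forest_rank[OF assms(2,3)] by blast
  show ?thesis
    by (rule forest_if_ranked[OF assms(1) layered_forests_edges[OF assms(2,3)]
          rooted_rankingD(2,3)[OF h]])
qed

text \<open>The edges that meet \<open>R\<close> are exactly those between \<open>R\<close> and the next layer \<open>T\<close>, because the rest
  of the forest avoids \<open>R\<close>. Hence the edge set together with \<open>R\<close> determines \<open>T\<close>, the parents of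
  its vertices and the remaining forest.\<close>
lemma layered_forests_inj:
  "inj_on (\<lambda>(T, g, F). (\<lambda>v. {v, g v}) ` T \<union> F)
    (SIGMA T:{T. T \<subseteq> S - R \<and> card T = s}. (T \<rightarrow>\<^sub>E R) \<times> layered_forests s M (S - R) T)"
proof (rule inj_onI, clarify, goal_cases)
  case (1 T g F T' g' F')
  let ?A = "(\<lambda>v. {v, g v}) ` T" and ?A' = "(\<lambda>v. {v, g' v}) ` T'"
  have eq: "?A \<union> F = ?A' \<union> F'" using 1 by simp
  have g: "\<And>v. v \<in> T \<Longrightarrow> g v \<in> R" "\<And>v. v \<in> T' \<Longrightarrow> g' v \<in> R" using 1 by auto
  have T: "T \<subseteq> S - R" "T' \<subseteq> S - R" using 1 by auto
  have inside: "F \<subseteq> vertex_pairs (S - R)" "F' \<subseteq> vertex_pairs (S - R)"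
    using 1 layered_forests_edges[of T "S - R" F] layered_forests_edges[of T' "S - R" F'] by auto
  have cross: "e \<inter> R \<noteq> {}" if "e \<in> ?A \<or> e \<in> ?A'" for e using that g by auto
  have noncross: "e \<inter> R = {}" if "e \<in> F \<or> e \<in> F'" for e
    using that inside by (auto simp: vertex_pairs_def)
  have split: "X = X' \<and> Y = Y'" if "X \<union> Y = X' \<union> Y'"
    "\<And>e. e \<in> X \<or> e \<in> X' \<Longrightarrow> e \<inter> R \<noteq> {}" "\<And>e. e \<in> Y \<or> e \<in> Y' \<Longrightarrow> e \<inter> R = {}"
    for X X' Y Y' :: "'a set set"
    using that by blast
  have AA: "?A = ?A'" and FF: "F = F'" using split[OF eq cross noncross] by simp_all
  have sub: "v \<in> T' \<and> g v = g' v" if "v \<in> T" for v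
  proof -
    have "{v, g v} \<in> ?A'" using AA that by blast
    then obtain w where w: "w \<in> T'" "{v, g v} = {w, g' w}" by blast
    then have "v = w \<and> g v = g' w"
      using parent_edge_eq_iff[of v R w g g'] g that T by blast
    then show ?thesis using w(1) by blast
  qed
  have sub': "v \<in> T" if "v \<in> T'" for v
  proof -
    have "{v, g' v} \<in> ?A" using AA that by blast
    then obtain w where w: "w \<in> T" "{v, g' v} = {w, g w}" by blast
    then have "v = w" using parent_edge_eq_iff[of v R w g' g] g that T by blast
    then show ?thesis using w by simp
  qed
  have "T = T'" using sub sub' by blast
  moreover have "g = g'"
  proof (rule PiE_ext)
    show "g \<in> T \<rightarrow>\<^sub>E R" by (rule 1)
    show "g' \<in> T \<rightarrow>\<^sub>E R" unfolding \<open>T = T'\<close> by (rule 1)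
    show "g v = g' v" if "v \<in> T" for v using sub[OF that] by (rule conjunct2)
  qed
  ultimately show ?case using FF by simp
qed

text \<open>With \<open>a = card (S - R)\<close> there are \<open>a choose s\<close> next layers and \<open>s ^ s\<close> choices of parents for
  each, and the same count recurs with \<open>a - s\<close>. If fewer than \<open>s\<close> vertices are left over, the total
  is \<open>fact a * (s ^ s / fact s) ^ M\<close> up to a constant factor. As \<open>s ^ s / fact s\<close> falls short of
  \<open>exp s\<close> by a factor of order \<open>s\<close> at most, this is, up to a constant factor, at least
  \<open>a ^ a * (1 - \<delta>) ^ a\<close> with \<open>\<delta>\<close> as small as desired for large \<open>s\<close>.\<close>
lemma card_layered_forests:
  "finite S \<Longrightarrow> R \<subseteq> S \<Longrightarrow> card R = s \<Longrightarrow> s * M \<le> card (S - R) \<Longrightarrow>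
    card (layered_forests s M S R) * fact s ^ M * fact (card (S - R) - s * M)
      = fact (card (S - R)) * s ^ (s * M)"
proof (induction M arbitrary: S R)
  case (Suc M)
  let ?a = "card (S - R)" and ?Ts = "{T. T \<subseteq> S - R \<and> card T = s}"
  have fin: "finite (S - R)" using Suc.prems by simp
  have finT: "finite T" if "T \<in> ?Ts" for T using that fin finite_subset by blast
  have sa: "s \<le> ?a" using Suc.prems(4) by simp
  have IH: "card (layered_forests s M (S - R) T) * fact s ^ M * fact (?a - s - s * M)
      = fact (?a - s) * s ^ (s * M)" if "T \<in> ?Ts" for T
  proof -
    have c: "card (S - R - T) = ?a - s" using that finT[OF that] by (simp add: card_Diff_subset)
    show ?thesis using Suc.IH[of "S - R" T] that fin Suc.prems(4) unfolding c by simp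
  qed
  have "card (layered_forests s (Suc M) S R)
      = card (SIGMA T:?Ts. (T \<rightarrow>\<^sub>E R) \<times> layered_forests s M (S - R) T)"
    unfolding layered_forests.simps by (rule card_image[OF layered_forests_inj])
  also have "\<dots> = (\<Sum>T\<in>?Ts. card ((T \<rightarrow>\<^sub>E R) \<times> layered_forests s M (S - R) T))"
  proof (rule card_SigmaI)
    show "finite ?Ts" using fin by simp
    have "finite R" using Suc.prems(1,2) finite_subset by blast
    then have "finite ((T \<rightarrow>\<^sub>E R) \<times> layered_forests s M (S - R) T)" if "T \<in> ?Ts" for T
      using finT[OF that] that finite_layered_forests[OF fin, of T s M] by (simp add: finite_PiE)
    then show "\<forall>T\<in>?Ts. finite ((T \<rightarrow>\<^sub>E R) \<times> layered_forests s M (S - R) T)" by blast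
  qed
  also have "\<dots> = (\<Sum>T\<in>?Ts. s ^ s * card (layered_forests s M (S - R) T))"
  proof (intro sum.cong refl)
    fix T assume T: "T \<in> ?Ts"
    then show "card ((T \<rightarrow>\<^sub>E R) \<times> layered_forests s M (S - R) T)
        = s ^ s * card (layered_forests s M (S - R) T)"
      using finT[OF T] Suc.prems(3) by (simp add: card_cartesian_product card_PiE)
  qed
  finally have "card (layered_forests s (Suc M) S R) * fact s ^ Suc M * fact (?a - s * Suc M)
      = (\<Sum>T\<in>?Ts. s ^ s * card (layered_forests s M (S - R) T)) * fact s ^ Suc M * fact (?a - s - s * M)"
    by (simp add: algebra_simps)
  also have "\<dots> = (\<Sum>T\<in>?Ts. s ^ s * fact s *
      (card (layered_forests s M (S - R) T) * fact s ^ M * fact (?a - s - s * M)))"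
    unfolding sum_distrib_right by (intro sum.cong refl) (simp add: mult_ac)
  also have "\<dots> = (\<Sum>T\<in>?Ts. s ^ s * fact s * (fact (?a - s) * s ^ (s * M)))"
    by (intro sum.cong refl) (simp only: IH)
  also have "\<dots> = (fact s * fact (?a - s) * (?a choose s)) * s ^ (s * Suc M)"
    using n_subsets[OF fin, of s] by (simp add: power_add mult_ac)
  also have "\<dots> = fact ?a * s ^ (s * Suc M)"
    using binomial_fact_lemma[OF sa] by simp
  finally show ?case .
qed simp

section \<open>The first moment\<close>

text \<open>A union bound over all parent functions on \<open>S\<close>. A forest with \<open>d\<close> edges has probability
  \<open>(1 - p) ^ (k choose 2) * (p / (1 - p)) ^ d\<close>, and the sum over parent functions is a product over
  the vertices: each chooses to be a root, with weight \<open>1\<close>, or one of fewer than \<open>k\<close> parents, with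
  weight \<open>p / (1 - p)\<close>.\<close>
lemma prob_induced_forest_on_le:
  fixes p :: real
  assumes p: "0 < p" "p < 1" and S: "S \<subseteq> {1..n}" "card S = k"
  shows "measure_pmf.prob (binomial_random_graph n p) {G. forest (S, edges G \<inter> vertex_pairs S)}
    \<le> (1 - p) ^ (k choose 2) * (1 + real k * (p / (1 - p))) ^ k"
proof -
  let ?M = "binomial_random_graph n p" and ?l = "p / (1 - p)"
  define d where "d = (\<lambda>f. card {v \<in> S. f v \<noteq> v})"
  define \<Phi> where "\<Phi> = {f \<in> S \<rightarrow>\<^sub>E S. card (parent_edges S f) = d f}"
  have finS: "finite S" using S(1) finite_subset by blast
  have finPi: "finite (S \<rightarrow>\<^sub>E S)" using finS by (simp add: finite_PiE)
  have fin\<Phi>: "finite \<Phi>" using finPi by (simp add: \<Phi>_def)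
  have lam: "0 \<le> ?l" using p by simp
  have sub: "parent_edges S f \<subseteq> vertex_pairs S" if "f \<in> S \<rightarrow>\<^sub>E S" for f
  proof -
    have "f v \<in> S" if "v \<in> S" for v using that \<open>f \<in> S \<rightarrow>\<^sub>E S\<close> by auto
    then show ?thesis by (auto simp: parent_edges_def vertex_pairs_def)
  qed
  have "measure_pmf.prob ?M {G. forest (S, edges G \<inter> vertex_pairs S)}
      \<le> measure_pmf.prob ?M (\<Union>f\<in>\<Phi>. {G. edges G \<inter> vertex_pairs S = parent_edges S f})"
  proof (intro measure_pmf.finite_measure_mono subsetI)
    fix G :: "nat graph"
    assume "G \<in> {G. forest (S, edges G \<inter> vertex_pairs S)}"
    then have "forest (S, edges G \<inter> vertex_pairs S)" by simp
    from forest_parent_function[OF this] obtain f where "f \<in> S \<rightarrow>\<^sub>E S"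
      "edges G \<inter> vertex_pairs S = parent_edges S f"
      "card (edges G \<inter> vertex_pairs S) = d f" unfolding d_def by (elim bexE conjE)
    then show "G \<in> (\<Union>f\<in>\<Phi>. {G. edges G \<inter> vertex_pairs S = parent_edges S f})"
      unfolding \<Phi>_def by (intro UN_I[of f]) simp_all
  qed simp
  also have "\<dots> \<le> (\<Sum>f\<in>\<Phi>. measure_pmf.prob ?M {G. edges G \<inter> vertex_pairs S = parent_edges S f})"
    using fin\<Phi> by (intro measure_pmf.finite_measure_subadditive_finite) auto
  also have "\<dots> = (\<Sum>f\<in>\<Phi>. (1 - p) ^ (k choose 2) * ?l ^ d f)"
  proof (intro sum.cong refl)
    fix f assume f: "f \<in> \<Phi>"
    then have fP: "f \<in> S \<rightarrow>\<^sub>E S" and c: "card (parent_edges S f) = d f" by (simp_all add: \<Phi>_def)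
    have cV: "card (vertex_pairs S) = k choose 2" using card_vertex_pairs[OF finS] S(2) by simp
    have le: "d f \<le> k choose 2"
      using card_mono[OF finite_vertex_pairs[OF finS] sub[OF fP]] c cV by simp
    have "measure_pmf.prob ?M {G. edges G \<inter> vertex_pairs S = parent_edges S f}
        = p ^ d f * (1 - p) ^ ((k choose 2) - d f)"
      using prob_edge_pattern[OF _ _ vertex_pairs_mono[OF S(1)] sub[OF fP], of p] p c cV
      by (simp add: pattern_prob_def)
    also have "\<dots> = (1 - p) ^ (k choose 2) * ?l ^ d f"
      using p le by (simp add: power_diff power_divide)
    finally show "measure_pmf.prob ?M {G. edges G \<inter> vertex_pairs S = parent_edges S f}
        = (1 - p) ^ (k choose 2) * ?l ^ d f" .
  qed
  also have "\<dots> \<le> (\<Sum>f\<in>S \<rightarrow>\<^sub>E S. (1 - p) ^ (k choose 2) * ?l ^ d f)"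
    using p finPi by (intro sum_mono2) (simp_all add: \<Phi>_def)
  also have "\<dots> = (1 - p) ^ (k choose 2) * (\<Sum>f\<in>S \<rightarrow>\<^sub>E S. \<Prod>v\<in>S. if f v \<noteq> v then ?l else 1)"
    unfolding sum_distrib_left d_def using finS by (simp add: prod.If_cases Int_def conj_commute)
  also have "(\<Sum>f\<in>S \<rightarrow>\<^sub>E S. \<Prod>v\<in>S. if f v \<noteq> v then ?l else 1)
      = (\<Prod>v\<in>S. \<Sum>u\<in>S. if u \<noteq> v then ?l else 1)"
    using finS by (subst prod_sum_PiE) simp_all
  also have "\<dots> \<le> (\<Prod>v\<in>S. 1 + real k * ?l)"
  proof (intro prod_mono conjI)
    fix v assume v: "v \<in> S"
    show "0 \<le> (\<Sum>u\<in>S. if u \<noteq> v then ?l else 1)" using lam by (intro sum_nonneg) auto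
    have "(\<Sum>u\<in>S. if u \<noteq> v then ?l else 1) = 1 + (\<Sum>u\<in>S - {v}. ?l)"
      using finS v by (subst sum.remove[of S v]) simp_all
    also have "\<dots> \<le> 1 + (\<Sum>u\<in>S. ?l)"
      using finS lam by (intro add_left_mono sum_mono2) auto
    finally show "(\<Sum>u\<in>S. if u \<noteq> v then ?l else 1) \<le> 1 + real k * ?l" using S(2) by simp
  qed
  also have "\<dots> = (1 + real k * ?l) ^ k" using S(2) by simp
  finally show ?thesis using p by (simp add: mult_left_mono)
qed

lemma first_moment_bound:
  fixes p :: real
  assumes p: "0 < p" "p < 1"
  shows "measure_pmf.prob (binomial_random_graph n p) {G. k \<le> max_induced_forest_size G}
    \<le> real (n choose k) * ((1 - p) ^ (k choose 2) * (1 + real k * (p / (1 - p))) ^ k)"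
proof -
  let ?M = "binomial_random_graph n p"
  let ?I = "{S. S \<subseteq> {1..n} \<and> card S = k}"
  let ?B = "(1 - p) ^ (k choose 2) * (1 + real k * (p / (1 - p))) ^ k"
  have "measure_pmf.prob ?M {G. k \<le> max_induced_forest_size G}
      = measure_pmf.prob ?M ({G. k \<le> max_induced_forest_size G} \<inter> set_pmf ?M)"
    by (simp add: measure_Int_set_pmf)
  also have "\<dots> \<le> measure_pmf.prob ?M (\<Union>S\<in>?I. {G. forest (S, edges G \<inter> vertex_pairs S)})"
  proof (intro measure_pmf.finite_measure_mono subsetI)
    fix G assume "G \<in> {G. k \<le> max_induced_forest_size G} \<inter> set_pmf ?M"
    then have "k \<le> max_induced_forest_size G" "simple_graph G" "verts G = {1..n}"
      using simple_graph_binomial_random_graph[of G n p] by simp_all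
    then show "G \<in> (\<Union>S\<in>?I. {G. forest (S, edges G \<inter> vertex_pairs S)})"
      using max_induced_forest_size_ge_iff[of G k] by auto
  qed simp
  also have "\<dots> \<le> (\<Sum>S\<in>?I. measure_pmf.prob ?M {G. forest (S, edges G \<inter> vertex_pairs S)})"
    by (intro measure_pmf.finite_measure_subadditive_finite) auto
  also have "\<dots> \<le> (\<Sum>S\<in>?I. ?B)"
    using prob_induced_forest_on_le[OF p] by (intro sum_mono) auto
  also have "\<dots> = real (n choose k) * ?B" by (simp add: n_subsets)
  finally show ?thesis .
qed

section \<open>Counting subsets\<close>

lemma card_bounded_subsets_le:
  assumes "finite B"
  shows "card {X. X \<subseteq> B \<and> card X \<le> a} \<le> (card B + 1) ^ a"
proof -
  have "{X. X \<subseteq> B \<and> card X \<le> a} = (\<Union>i\<in>{..a}. {X. X \<subseteq> B \<and> card X = i})" by auto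
  then have "card {X. X \<subseteq> B \<and> card X \<le> a} \<le> (\<Sum>i\<le>a. card {X. X \<subseteq> B \<and> card X = i})"
    using card_UN_le[of "{..a}" "\<lambda>i. {X. X \<subseteq> B \<and> card X = i}"] by simp
  also have "\<dots> \<le> (\<Sum>i\<le>a. card B ^ i)"
  proof (intro sum_mono)
    fix i
    show "card {X. X \<subseteq> B \<and> card X = i} \<le> card B ^ i"
      using assms binomial_le_pow[of i "card B"] by (cases "i \<le> card B") (simp_all add: n_subsets binomial_eq_0)
  qed
  also have "\<dots> \<le> (card B + 1) ^ a"
  proof (induction a)
    case (Suc a)
    have "card B ^ Suc a \<le> card B * (card B + 1) ^ a"
      unfolding power_Suc by (intro mult_left_mono power_mono) simp_all
    then have "(\<Sum>i\<le>Suc a. card B ^ i) \<le> (card B + 1) ^ a + card B * (card B + 1) ^ a"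
      using Suc.IH by (simp only: sum.atMost_Suc)
    also have "\<dots> = (card B + 1) ^ Suc a" by (simp add: algebra_simps)
    finally show ?case .
  qed simp
  finally show ?thesis .
qed

text \<open>A uniformly random \<open>k\<close>-subset of an \<open>n\<close>-set contains \<open>l\<close> given points with probability at most
  \<open>(k / n) ^ l\<close>.\<close>
lemma binomial_diff_le:
  fixes n k l :: nat
  assumes "l \<le> k" "k \<le> n" "0 < n"
  shows "real ((n - l) choose (k - l)) \<le> (real k / real n) ^ l * real (n choose k)"
  using assms(1)
proof (induction l)
  case (Suc l)
  then have l: "l < k" "l < n" using assms by auto
  have "(n - l) * ((n - Suc l) choose (k - Suc l)) = (k - l) * ((n - l) choose (k - l))"
    using times_binomial_minus1_eq[of "k - l" "n - l"] l by simp
  then have "real (n - l) * real ((n - Suc l) choose (k - Suc l))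
      = real (k - l) * real ((n - l) choose (k - l))"
    by (metis of_nat_mult)
  then have "real ((n - Suc l) choose (k - Suc l))
      = real (k - l) / real (n - l) * real ((n - l) choose (k - l))"
    using l by (simp add: field_simps)
  also have "\<dots> \<le> real k / real n * real ((n - l) choose (k - l))"
  proof (intro mult_right_mono)
    have "real l * real k \<le> real l * real n" using assms(2) by (intro mult_left_mono) auto
    then show "real (k - l) / real (n - l) \<le> real k / real n"
      using l assms by (simp add: field_simps of_nat_diff)
  qed simp
  also have "\<dots> \<le> real k / real n * ((real k / real n) ^ l * real (n choose k))"
    using Suc by (intro mult_left_mono) simp_all
  finally show ?case by simp
qed simp

text \<open>A set is determined by its traces inside and outside \<open>S\<close>.\<close>
lemma card_subsets_with_overlap_le:
  assumes "finite V" "S \<subseteq> V" "card S = k" "card V = n" "l \<le> k"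
  shows "card {S'. S' \<subseteq> V \<and> card S' = k \<and> card (S \<inter> S') = l}
    \<le> (k choose l) * ((n - k) choose (k - l))"
proof -
  let ?A = "{S'. S' \<subseteq> V \<and> card S' = k \<and> card (S \<inter> S') = l}"
  let ?B = "{X. X \<subseteq> S \<and> card X = l} \<times> {Y. Y \<subseteq> V - S \<and> card Y = k - l}"
  have finS: "finite S" using assms finite_subset by blast
  have "inj_on (\<lambda>S'. (S \<inter> S', S' - S)) ?A"
    by (rule inj_onI) (metis Int_Diff_Un Int_commute Pair_inject)
  moreover have "(\<lambda>S'. (S \<inter> S', S' - S)) ` ?A \<subseteq> ?B"
  proof (intro image_subsetI)
    fix S' assume S': "S' \<in> ?A"
    then have "finite S'" using assms(1) finite_subset by blast
    then have "card (S' - S) = k - l" using S' by (simp add: card_Diff_subset_Int Int_commute)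
    then show "(S \<inter> S', S' - S) \<in> ?B" using S' by blast
  qed
  moreover have "finite ?B" using assms(1) finS by simp
  ultimately have "card ?A \<le> card ?B" using card_inj_on_le by blast
  also have "\<dots> = (k choose l) * ((n - k) choose (k - l))"
    using assms finS by (simp add: card_cartesian_product n_subsets card_Diff_subset)
  finally show ?thesis .
qed

section \<open>Overlapping copies from a family of bounded degree\<close>

text \<open>A family \<open>\<F> S\<close> of target graphs on each \<open>k\<close>-set \<open>S\<close>, all families of the same size and all targets
  with the same number of edges and with degrees at most \<open>\<Delta>\<close>. These properties alone control the
  second moment of the number of \<open>k\<close>-sets whose induced graph is a target.\<close>
locale bounded_degree_family =
  fixes p :: real and n k m \<Delta> N :: nat and \<F> :: "nat set \<Rightarrow> nat set set set"
  assumes p: "0 < p" "p < 1"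
    and card_family: "\<And>S. S \<subseteq> {1..n} \<Longrightarrow> card S = k \<Longrightarrow> card (\<F> S) = N"
    and edges_family: "\<And>S F. S \<subseteq> {1..n} \<Longrightarrow> card S = k \<Longrightarrow> F \<in> \<F> S \<Longrightarrow> F \<subseteq> vertex_pairs S"
    and size_family: "\<And>S F. S \<subseteq> {1..n} \<Longrightarrow> card S = k \<Longrightarrow> F \<in> \<F> S \<Longrightarrow> card F = m"
    and degree_family: "\<And>S F v. S \<subseteq> {1..n} \<Longrightarrow> card S = k \<Longrightarrow> F \<in> \<F> S \<Longrightarrow> card {e \<in> F. v \<in> e} \<le> \<Delta>"
begin

abbreviation "M \<equiv> binomial_random_graph n p"

definition hit :: "nat set \<Rightarrow> nat graph set" where
  "hit S = {G. edges G \<inter> vertex_pairs S \<in> \<F> S}"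

definition hit_prob :: real where
  "hit_prob = real N * (p ^ m * (1 - p) ^ ((k choose 2) - m))"

context
  fixes S assumes S: "S \<subseteq> {1..n}" "card S = k"
begin

lemma finite_S: "finite S" using S finite_subset by blast

lemma finite_VS: "finite (vertex_pairs S)" using finite_S by (rule finite_vertex_pairs)

lemma card_VS: "card (vertex_pairs S) = k choose 2"
  using card_vertex_pairs[OF finite_S] S by simp

lemma finite_FS: "finite (\<F> S)"
  using edges_family[OF S] finite_VS by (meson PowI finite_Pow_iff finite_subset subsetI)

lemma finite_member: "F \<in> \<F> S \<Longrightarrow> finite F"
  using edges_family[OF S] finite_VS finite_subset by blast

lemma pattern_prob_member: "F \<in> \<F> S \<Longrightarrow>
    pattern_prob p (vertex_pairs S) F = p ^ m * (1 - p) ^ ((k choose 2) - m)"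
  using size_family[OF S] card_VS by (simp add: pattern_prob_def)

lemma prob_hit: "measure_pmf.prob M (hit S) = hit_prob"
proof -
  have "hit S = (\<Union>F\<in>\<F> S. {G. edges G \<inter> vertex_pairs S = F})"
    by (auto simp: hit_def)
  also have "measure_pmf.prob M \<dots> = (\<Sum>F\<in>\<F> S. measure_pmf.prob M {G. edges G \<inter> vertex_pairs S = F})"
    using finite_FS by (intro measure_pmf.finite_measure_finite_Union) (auto simp: disjoint_family_on_def)
  also have "\<dots> = (\<Sum>F\<in>\<F> S. p ^ m * (1 - p) ^ ((k choose 2) - m))"
    using prob_edge_pattern[OF _ _ vertex_pairs_mono[OF S(1)] edges_family[OF S], of p]
      pattern_prob_member p
    by (intro sum.cong refl) simp
  finally show ?thesis using card_family[OF S] by (simp add: hit_prob_def)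
qed

text \<open>All that is used of the degree bound. It is applied both to the common vertices of two \<open>k\<close>-sets and
  to the new vertices of the second one: whichever part is small carries few edges of a target.\<close>
lemma card_edges_touching:
  assumes "F \<in> \<F> S" "finite D"
  shows "card {e \<in> F. e \<inter> D \<noteq> {}} \<le> \<Delta> * card D"
proof -
  have "{e \<in> F. e \<inter> D \<noteq> {}} = (\<Union>v\<in>D. {e \<in> F. v \<in> e})" by auto
  then have "card {e \<in> F. e \<inter> D \<noteq> {}} \<le> (\<Sum>v\<in>D. card {e \<in> F. v \<in> e})"
    using card_UN_le[OF assms(2)] by metis
  also have "\<dots> \<le> (\<Sum>v\<in>D. \<Delta>)" using degree_family[OF S assms(1)] by (intro sum_mono) auto
  finally show ?thesis by (simp add: mult.commute)
qed

end

text \<open>Given the graph \<open>F\<close> on \<open>S\<close>, only targets on \<open>S'\<close> that agree with it on the common pairs can still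
  occur, and \<open>extension_prob\<close> is the conditional probability that one of them does.\<close>
definition compatible :: "nat set \<Rightarrow> nat set \<Rightarrow> nat set set \<Rightarrow> nat set set set" where
  "compatible S S' F = {F' \<in> \<F> S'. F' \<inter> vertex_pairs S = F \<inter> vertex_pairs S'}"

definition extension_prob :: "nat set \<Rightarrow> nat set \<Rightarrow> nat set set \<Rightarrow> real" where
  "extension_prob S S' F = (\<Sum>F'\<in>compatible S S' F.
     pattern_prob p (vertex_pairs S' - vertex_pairs S) (F' - vertex_pairs S))"

context
  fixes S S' assumes S: "S \<subseteq> {1..n}" "card S = k" and S': "S' \<subseteq> {1..n}" "card S' = k"
begin

lemma prob_hit_both_le:
  "measure_pmf.prob M (hit S \<inter> hit S')
    \<le> (\<Sum>F\<in>\<F> S. pattern_prob p (vertex_pairs S) F * extension_prob S S' F)"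
proof -
  let ?Q = "vertex_pairs S" and ?Q' = "vertex_pairs S'"
  let ?A = "\<lambda>F F'. {G :: nat graph. edges G \<inter> (?Q \<union> (?Q' - ?Q)) = F \<union> (F' - ?Q)}"
  have finc: "finite (compatible S S' F)" for F using finite_FS[OF S'] by (simp add: compatible_def)
  have "measure_pmf.prob M (hit S \<inter> hit S')
      \<le> measure_pmf.prob M (\<Union>F\<in>\<F> S. \<Union>F'\<in>compatible S S' F. ?A F F')"
  proof (intro measure_pmf.finite_measure_mono subsetI)
    fix G assume G: "G \<in> hit S \<inter> hit S'"
    show "G \<in> (\<Union>F\<in>\<F> S. \<Union>F'\<in>compatible S S' F. ?A F F')"
    proof (rule UN_I[of "edges G \<inter> ?Q"], use G in \<open>simp add: hit_def\<close>,
        rule UN_I[of "edges G \<inter> ?Q'"])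
      show "edges G \<inter> ?Q' \<in> compatible S S' (edges G \<inter> ?Q)"
        using G by (auto simp: hit_def compatible_def)
    qed blast
  qed simp
  also have "\<dots> \<le> (\<Sum>F\<in>\<F> S. measure_pmf.prob M (\<Union>F'\<in>compatible S S' F. ?A F F'))"
    using finite_FS[OF S] by (intro measure_pmf.finite_measure_subadditive_finite) auto
  also have "\<dots> \<le> (\<Sum>F\<in>\<F> S. \<Sum>F'\<in>compatible S S' F. measure_pmf.prob M (?A F F'))"
    using finc by (intro sum_mono measure_pmf.finite_measure_subadditive_finite) auto
  also have "\<dots> = (\<Sum>F\<in>\<F> S. \<Sum>F'\<in>compatible S S' F.
      pattern_prob p ?Q F * pattern_prob p (?Q' - ?Q) (F' - ?Q))"
  proof (intro sum.cong refl)
    fix F F' assume F: "F \<in> \<F> S" and F': "F' \<in> compatible S S' F"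
    have sub: "F \<subseteq> ?Q" "F' - ?Q \<subseteq> ?Q' - ?Q"
      using edges_family[OF S F] edges_family[OF S', of F'] F' by (auto simp: compatible_def)
    have "?Q \<union> (?Q' - ?Q) \<subseteq> vertex_pairs {1..n}"
      using vertex_pairs_mono[OF S(1)] vertex_pairs_mono[OF S'(1)] by blast
    then have "measure_pmf.prob M (?A F F') = pattern_prob p (?Q \<union> (?Q' - ?Q)) (F \<union> (F' - ?Q))"
      using p sub by (intro prob_edge_pattern) auto
    also have "\<dots> = pattern_prob p ?Q F * pattern_prob p (?Q' - ?Q) (F' - ?Q)"
      using finite_VS[OF S] finite_VS[OF S'] sub by (intro pattern_prob_disjoint_union) auto
    finally show "measure_pmf.prob M (?A F F')
        = pattern_prob p ?Q F * pattern_prob p (?Q' - ?Q) (F' - ?Q)" .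
  qed
  also have "\<dots> = (\<Sum>F\<in>\<F> S. pattern_prob p ?Q F * extension_prob S S' F)"
    by (simp add: sum_distrib_left extension_prob_def)
  finally show ?thesis .
qed

lemma prob_hit_both_le_uniform:
  assumes "\<And>F. F \<in> \<F> S \<Longrightarrow> extension_prob S S' F \<le> B"
  shows "measure_pmf.prob M (hit S \<inter> hit S') \<le> hit_prob * B"
proof -
  have "measure_pmf.prob M (hit S \<inter> hit S')
    \<le> (\<Sum>F\<in>\<F> S. pattern_prob p (vertex_pairs S) F * extension_prob S S' F)"
    by (rule prob_hit_both_le)
  also have "\<dots> \<le> (\<Sum>F\<in>\<F> S. pattern_prob p (vertex_pairs S) F * B)"
    using assms p by (intro sum_mono mult_left_mono pattern_prob_nonneg) auto
  also have "\<dots> = hit_prob * B"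
    using card_family[OF S] by (simp add: pattern_prob_member[OF S] hit_prob_def)
  finally show ?thesis .
qed

text \<open>Forgetting the compatibility requirement, each target on \<open>S'\<close> loses from its probability only the
  factor for its part on the \<open>l\<close> common vertices. That part has at most \<open>\<Delta> * l\<close> edges, so this
  factor is at least \<open>p ^ (\<Delta> * l) * (1 - p) ^ (l choose 2)\<close>.\<close>
lemma extension_prob_small_overlap:
  assumes l: "card (S \<inter> S') = l"
  shows "extension_prob S S' F \<le> hit_prob / (p ^ (\<Delta> * l) * (1 - p) ^ (l choose 2))"
proof -
  let ?Q = "vertex_pairs S" and ?Q' = "vertex_pairs S'" and ?L = "S \<inter> S'"
  let ?c = "p ^ (\<Delta> * l) * (1 - p) ^ (l choose 2)"
  have finL: "finite ?L" using finite_S[OF S] by simp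
  have pos: "0 < ?c" using p by simp
  have "pattern_prob p (?Q' - ?Q) (F' - ?Q) \<le> p ^ m * (1 - p) ^ ((k choose 2) - m) / ?c"
    if F': "F' \<in> \<F> S'" for F'
  proof -
    have "pattern_prob p ((?Q' - ?Q) \<union> (?Q' \<inter> ?Q)) ((F' - ?Q) \<union> (F' \<inter> ?Q))
        = pattern_prob p (?Q' - ?Q) (F' - ?Q) * pattern_prob p (?Q' \<inter> ?Q) (F' \<inter> ?Q)"
      using edges_family[OF S' F'] finite_VS[OF S'] by (intro pattern_prob_disjoint_union) auto
    moreover have "(?Q' - ?Q) \<union> (?Q' \<inter> ?Q) = ?Q'" "(F' - ?Q) \<union> (F' \<inter> ?Q) = F'" by blast+
    ultimately have split: "p ^ m * (1 - p) ^ ((k choose 2) - m)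
        = pattern_prob p (?Q' - ?Q) (F' - ?Q) * pattern_prob p (?Q' \<inter> ?Q) (F' \<inter> ?Q)"
      using pattern_prob_member[OF S' F'] by simp
    have cL: "card (?Q' \<inter> ?Q) = l choose 2"
      using card_vertex_pairs[OF finL] l by (simp add: vertex_pairs_Int Int_commute)
    have "F' \<inter> ?Q \<subseteq> {e \<in> F'. e \<inter> ?L \<noteq> {}}"
    proof
      fix e assume e: "e \<in> F' \<inter> ?Q"
      then have "e \<subseteq> S" "card e = 2" "e \<subseteq> S'"
        using edges_family[OF S' F'] by (auto simp: vertex_pairs_def)
      moreover from this have "e \<noteq> {}" by auto
      ultimately show "e \<in> {e \<in> F'. e \<inter> ?L \<noteq> {}}" using e by blast
    qed
    then have "card (F' \<inter> ?Q) \<le> card {e \<in> F'. e \<inter> ?L \<noteq> {}}"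
      using finite_member[OF S' F'] by (intro card_mono) auto
    also have "\<dots> \<le> \<Delta> * l" using card_edges_touching[OF S' F' finL] l by simp
    finally have "?c \<le> pattern_prob p (?Q' \<inter> ?Q) (F' \<inter> ?Q)"
      unfolding pattern_prob_def cL using p by (intro mult_mono power_decreasing) auto
    then have "pattern_prob p (?Q' - ?Q) (F' - ?Q) * ?c \<le> p ^ m * (1 - p) ^ ((k choose 2) - m)"
      unfolding split using p by (intro mult_left_mono pattern_prob_nonneg) auto
    then show ?thesis using pos by (simp add: pos_le_divide_eq)
  qed
  then have "extension_prob S S' F \<le> (\<Sum>F'\<in>compatible S S' F. p ^ m * (1 - p) ^ ((k choose 2) - m) / ?c)"
    unfolding extension_prob_def by (intro sum_mono) (auto simp: compatible_def)
  also have "\<dots> \<le> (\<Sum>F'\<in>\<F> S'. p ^ m * (1 - p) ^ ((k choose 2) - m) / ?c)"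
    using finite_FS[OF S'] p by (intro sum_mono2) (auto simp: compatible_def)
  also have "\<dots> = hit_prob / ?c" using card_family[OF S'] by (simp add: hit_prob_def)
  finally show ?thesis .
qed

text \<open>If only \<open>r\<close> vertices of \<open>S'\<close> are new, a compatible target is determined by its at most \<open>\<Delta> * r\<close>
  edges touching them, which leaves at most \<open>(k\<^sup>2 + 1) ^ (\<Delta> * r)\<close> candidates. Each of them requires
  nearly all of the new pairs to be non-edges.\<close>
lemma extension_prob_large_overlap:
  assumes l: "card (S \<inter> S') = k - r" "r \<le> k"
  shows "extension_prob S S' F
    \<le> (((real k ^ 2 + 1) / (1 - p)) ^ \<Delta>) ^ r * (1 - p) ^ ((k choose 2) - ((k - r) choose 2))"
proof -
  let ?Q = "vertex_pairs S" and ?Q' = "vertex_pairs S'"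
  let ?C = "compatible S S' F" and ?D = "(k choose 2) - ((k - r) choose 2)"
  have fin: "finite (?Q' - ?Q)" using finite_VS[OF S'] by simp
  have cD: "card (?Q' - ?Q) = ?D"
  proof -
    have "card (?Q' \<inter> ?Q) = (k - r) choose 2"
      using card_vertex_pairs[of "S \<inter> S'"] finite_S[OF S] l by (simp add: vertex_pairs_Int Int_commute)
    then show ?thesis using card_VS[OF S'] finite_VS[OF S'] by (simp add: card_Diff_subset_Int)
  qed
  have small: "card (F' - ?Q) \<le> \<Delta> * r" if "F' \<in> \<F> S'" for F'
  proof -
    have "F' - ?Q \<subseteq> {e \<in> F'. e \<inter> (S' - S) \<noteq> {}}"
      using edges_family[OF S' that] by (auto simp: vertex_pairs_def)
    then have "card (F' - ?Q) \<le> card {e \<in> F'. e \<inter> (S' - S) \<noteq> {}}"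
      using finite_member[OF S' that] by (intro card_mono) auto
    also have "\<dots> \<le> \<Delta> * card (S' - S)"
      using card_edges_touching[OF S' that] finite_S[OF S'] by simp
    also have "card (S' - S) = r"
      using l S' finite_S[OF S'] by (simp add: card_Diff_subset_Int Int_commute)
    finally show ?thesis .
  qed
  have "inj_on (\<lambda>F'. F' - ?Q) ?C"
  proof (rule inj_onI)
    fix F1 F2 assume "F1 \<in> ?C" "F2 \<in> ?C" "F1 - ?Q = F2 - ?Q"
    then have "F1 - ?Q = F2 - ?Q" "F1 \<inter> ?Q = F2 \<inter> ?Q" by (simp_all add: compatible_def)
    then show "F1 = F2" by (metis Un_Diff_Int)
  qed
  moreover have "(\<lambda>F'. F' - ?Q) ` ?C \<subseteq> {X. X \<subseteq> ?Q' - ?Q \<and> card X \<le> \<Delta> * r}"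
    using small edges_family[OF S'] by (auto simp: compatible_def)
  moreover have "finite {X. X \<subseteq> ?Q' - ?Q \<and> card X \<le> \<Delta> * r}" using fin by simp
  ultimately have "card ?C \<le> card {X. X \<subseteq> ?Q' - ?Q \<and> card X \<le> \<Delta> * r}"
    using card_inj_on_le by blast
  also have "\<dots> \<le> (?D + 1) ^ (\<Delta> * r)"
    using card_bounded_subsets_le[OF fin, of "\<Delta> * r"] cD by simp
  also have "\<dots> \<le> (k ^ 2 + 1) ^ (\<Delta> * r)"
    using binomial_le_pow[of 2 k] by (cases "2 \<le> k") (auto intro!: power_mono simp: binomial_eq_0)
  finally have "real (card ?C) \<le> real ((k ^ 2 + 1) ^ (\<Delta> * r))" by (rule of_nat_mono)
  then have cC: "real (card ?C) \<le> (real k ^ 2 + 1) ^ (\<Delta> * r)"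
    by (simp add: add.commute)
  have each: "pattern_prob p (?Q' - ?Q) (F' - ?Q) \<le> (1 - p) ^ ?D / (1 - p) ^ (\<Delta> * r)"
    if F': "F' \<in> \<F> S'" for F'
  proof -
    let ?a = "card (F' - ?Q)"
    have aD: "?a \<le> ?D" using card_mono[OF fin, of "F' - ?Q"] edges_family[OF S' F'] cD by auto
    have "pattern_prob p (?Q' - ?Q) (F' - ?Q) \<le> 1 * (1 - p) ^ (?D - ?a)"
      unfolding pattern_prob_def cD using p by (intro mult_right_mono power_le_one) auto
    also have "\<dots> = (1 - p) ^ ?D / (1 - p) ^ ?a"
      unfolding mult_1 using p by (intro power_diff aD) simp
    also have "\<dots> \<le> (1 - p) ^ ?D / (1 - p) ^ (\<Delta> * r)"
      using small[OF F'] p by (intro divide_left_mono power_decreasing mult_pos_pos) auto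
    finally show ?thesis .
  qed
  have "extension_prob S S' F \<le> (\<Sum>F'\<in>?C. (1 - p) ^ ?D / (1 - p) ^ (\<Delta> * r))"
    unfolding extension_prob_def using each by (intro sum_mono) (auto simp: compatible_def)
  also have "\<dots> = real (card ?C) * ((1 - p) ^ ?D / (1 - p) ^ (\<Delta> * r))" by simp
  also have "\<dots> \<le> (real k ^ 2 + 1) ^ (\<Delta> * r) * ((1 - p) ^ ?D / (1 - p) ^ (\<Delta> * r))"
    using cC p by (intro mult_right_mono) auto
  also have "\<dots> = (((real k ^ 2 + 1) / (1 - p)) ^ \<Delta>) ^ r * (1 - p) ^ ?D"
    by (simp add: power_mult power_divide)
  finally show ?thesis .
qed

end

end

section \<open>The second moment of the number of copies\<close>

lemma real_choose_two: "real (j choose 2) = real j * (real j - 1) / 2"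
proof -
  have "even (j * (j - 1))" by (cases j) auto
  then have "real (j choose 2) = real (j * (j - 1)) / 2"
    unfolding choose_two by (simp add: real_of_nat_div)
  then show ?thesis by (cases j) (auto simp: algebra_simps)
qed

lemma powr_mult_of_nat: "0 < x \<Longrightarrow> x powr (a * real j) = (x powr a) ^ j" for x :: real
  by (simp add: powr_powr flip: powr_realpow)

text \<open>The ratios of the geometric sequences that bound the contributions, to the second moment, of pairs
  of \<open>k\<close>-sets with at most \<open>3 * k / 4\<close> common vertices (in powers of the number of common vertices)
  and with more common vertices (in powers of the number of new vertices). When \<open>n\<close>
  is of the order \<open>(1 - p) powr (- k / 2)\<close>, both are exponentially small in \<open>k\<close>. The cut at
  \<open>3 * k / 4\<close> is arbitrary: exponents with this property exist for any other fixed fraction of \<open>k\<close>.\<close>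
definition far_ratio :: "real \<Rightarrow> nat \<Rightarrow> nat \<Rightarrow> nat \<Rightarrow> real" where
  "far_ratio p n k \<Delta> = real k ^ 2 / (p ^ \<Delta> * real n) * (1 - p) powr (- (3 / 8 * real k))"

definition near_ratio :: "real \<Rightarrow> nat \<Rightarrow> nat \<Rightarrow> nat \<Rightarrow> real" where
  "near_ratio p n k \<Delta> =
    real k * real n * ((real k ^ 2 + 1) / (1 - p)) ^ \<Delta> * (1 - p) powr (3 / 4 * real k)"

context bounded_degree_family
begin

definition mean_count :: real where
  "mean_count = real (n choose k) * hit_prob"

definition overlap_bound :: "nat \<Rightarrow> real" where
  "overlap_bound l = (if 4 * l \<le> 3 * k
     then hit_prob / (p ^ (\<Delta> * l) * (1 - p) ^ (l choose 2))
     else (((real k ^ 2 + 1) / (1 - p)) ^ \<Delta>) ^ (k - l) * (1 - p) ^ ((k choose 2) - (l choose 2)))"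

lemma hit_prob_nonneg: "0 \<le> hit_prob"
  using p by (simp add: hit_prob_def)

lemma overlap_bound_nonneg: "0 \<le> overlap_bound l"
  using p hit_prob_nonneg by (simp add: overlap_bound_def)

lemma prob_hit_both_overlap:
  assumes S: "S \<subseteq> {1..n}" "card S = k" and S': "S' \<subseteq> {1..n}" "card S' = k"
  shows "measure_pmf.prob M (hit S \<inter> hit S') \<le> hit_prob * overlap_bound (card (S \<inter> S'))"
proof (rule prob_hit_both_le_uniform[OF S S'])
  fix F
  let ?l = "card (S \<inter> S')"
  have "?l \<le> k" using card_mono[OF finite_S[OF S], of "S \<inter> S'"] S by simp
  then have "?l = k - (k - ?l)" "k - ?l \<le> k" by auto
  from extension_prob_large_overlap[OF S S' this]
  have "extension_prob S S' F \<le> (((real k ^ 2 + 1) / (1 - p)) ^ \<Delta>) ^ (k - ?l)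
      * (1 - p) ^ ((k choose 2) - (?l choose 2))"
    using \<open>?l \<le> k\<close> by simp
  then show "extension_prob S S' F \<le> overlap_bound ?l"
    using extension_prob_small_overlap[OF S S' refl, of F] by (simp add: overlap_bound_def)
qed

text \<open>The product on the left bounds the total contribution of the sets \<open>S'\<close> with \<open>l\<close> vertices in
  common with \<open>S\<close>. The choice of \<open>S'\<close> accounts for \<open>(k\<^sup>2 / n) ^ l\<close>, and
  \<open>l choose 2 \<le> 3 / 8 * k * l\<close> for the power of \<open>1 - p\<close>.\<close>
lemma far_term_le:
  assumes "k \<le> n" "0 < n" "4 * l \<le> 3 * k"
  shows "real ((k choose l) * ((n - k) choose (k - l))) * overlap_bound l \<le> mean_count * far_ratio p n k \<Delta> ^ l"
proof -
  have lk: "l \<le> k" using assms(3) by simp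
  have kl: "real (k choose l) \<le> real k ^ l"
    using binomial_le_pow[OF lk] by (metis of_nat_le_iff of_nat_power)
  have "real ((n - k) choose (k - l)) \<le> real ((n - l) choose (k - l))"
    using binomial_right_mono[of "n - k" "n - l" "k - l"] lk by simp
  also have "\<dots> \<le> (real k / real n) ^ l * real (n choose k)"
    using binomial_diff_le[OF lk assms(1,2)] .
  finally have chooses: "real ((k choose l) * ((n - k) choose (k - l)))
      \<le> real k ^ l * ((real k / real n) ^ l * real (n choose k))"
    using kl by (simp add: mult_mono)
  have "inverse ((1 - p) ^ (l choose 2)) \<le> ((1 - p) powr (- (3 / 8 * real k))) ^ l"
  proof -
    have "real l * (4 * real l) \<le> real l * (3 * real k)"
      using assms(3) by (intro mult_left_mono) linarith+
    then have "real (l choose 2) \<le> 3 / 8 * real k * real l"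
      unfolding real_choose_two by (simp add: algebra_simps)
    have "inverse ((1 - p) ^ (l choose 2)) = (1 - p) powr (- real (l choose 2))"
      using p by (simp add: powr_minus powr_realpow)
    also have "\<dots> \<le> (1 - p) powr (- (3 / 8 * real k) * real l)"
      using p \<open>real (l choose 2) \<le> 3 / 8 * real k * real l\<close> by (intro powr_mono') auto
    also have "\<dots> = ((1 - p) powr (- (3 / 8 * real k))) ^ l"
      using p by (intro powr_mult_of_nat) simp
    finally show ?thesis .
  qed
  then have "hit_prob * (inverse (p ^ \<Delta>) ^ l * inverse ((1 - p) ^ (l choose 2)))
      \<le> hit_prob * (inverse (p ^ \<Delta>) ^ l * ((1 - p) powr (- (3 / 8 * real k))) ^ l)"
    using hit_prob_nonneg p by (intro mult_left_mono) simp_all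
  moreover have "overlap_bound l = hit_prob * (inverse (p ^ \<Delta>) ^ l * inverse ((1 - p) ^ (l choose 2)))"
    using assms(3) unfolding overlap_bound_def
    by (simp only: if_True divide_inverse inverse_mult_distrib power_mult power_inverse)
  ultimately have "overlap_bound l
      \<le> hit_prob * (inverse (p ^ \<Delta>) ^ l * ((1 - p) powr (- (3 / 8 * real k))) ^ l)"
    by simp
  with chooses have "real ((k choose l) * ((n - k) choose (k - l))) * overlap_bound l
      \<le> (real k ^ l * ((real k / real n) ^ l * real (n choose k)))
        * (hit_prob * (inverse (p ^ \<Delta>) ^ l * ((1 - p) powr (- (3 / 8 * real k))) ^ l))"
    using overlap_bound_nonneg by (intro mult_mono) auto
  also have "\<dots> = mean_count * (real k * (real k / real n) * (inverse (p ^ \<Delta>)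
      * (1 - p) powr (- (3 / 8 * real k)))) ^ l"
    unfolding mean_count_def power_mult_distrib by (simp only: mult_ac)
  also have "real k * (real k / real n) * (inverse (p ^ \<Delta>) * (1 - p) powr (- (3 / 8 * real k)))
      = far_ratio p n k \<Delta>"
    unfolding far_ratio_def
    by (simp only: power2_eq_square divide_inverse inverse_mult_distrib mult_ac)
  finally show ?thesis .
qed

text \<open>With \<open>r = k - l\<close> new vertices there are at most \<open>k ^ r * n ^ r\<close> choices of \<open>S'\<close>, against at least
  \<open>3 / 4 * k * r\<close> new pairs.\<close>
lemma near_term_le:
  assumes "3 \<le> k" "k \<le> n" "l \<le> k" "3 * k < 4 * l"
  shows "real ((k choose l) * ((n - k) choose (k - l))) * overlap_bound l \<le> near_ratio p n k \<Delta> ^ (k - l)"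
proof -
  define r where "r = k - l"
  have l: "l = k - r" "r \<le> k" "4 * r < k" using assms by (auto simp: r_def)
  let ?K = "((real k ^ 2 + 1) / (1 - p)) ^ \<Delta>"
  have "real (k choose l) \<le> real k ^ r"
    using binomial_le_pow[OF l(2)] binomial_symmetric[OF l(2)] l(1) by (metis of_nat_le_iff of_nat_power)
  moreover have "real ((n - k) choose r) \<le> real n ^ r"
  proof -
    have "(n - k) choose r \<le> n choose r" by (intro binomial_right_mono) simp
    also have "\<dots> \<le> n ^ r" using l assms by (intro binomial_le_pow) simp
    finally show ?thesis by (metis of_nat_le_iff of_nat_power)
  qed
  ultimately have chooses: "real ((k choose l) * ((n - k) choose r)) \<le> real k ^ r * real n ^ r"
    by (simp add: mult_mono)
  have "(1 - p) ^ ((k choose 2) - (l choose 2)) \<le> ((1 - p) powr (3 / 4 * real k)) ^ r"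
  proof -
    have le: "l choose 2 \<le> k choose 2" using assms(3) by (rule binomial_right_mono)
    have rl: "real l = real k - real r" using l by (simp add: of_nat_diff)
    have "0 \<le> real r * (real k / 2 - real r - 1)"
      using l assms(1) by (intro mult_nonneg_nonneg) linarith+
    then have "3 / 4 * real k * real r \<le> real ((k choose 2) - (l choose 2))"
      unfolding of_nat_diff[OF le] real_choose_two rl by (simp add: field_simps)
    then have "(1 - p) powr real ((k choose 2) - (l choose 2)) \<le> (1 - p) powr (3 / 4 * real k * real r)"
      using p by (intro powr_mono') auto
    also have "\<dots> = ((1 - p) powr (3 / 4 * real k)) ^ r"
      using p by (intro powr_mult_of_nat) simp
    finally show ?thesis using p by (simp add: powr_realpow)
  qed
  then have "?K ^ r * (1 - p) ^ ((k choose 2) - (l choose 2)) \<le> ?K ^ r * ((1 - p) powr (3 / 4 * real k)) ^ r"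
    using p by (intro mult_left_mono) simp_all
  moreover have "overlap_bound l = ?K ^ r * (1 - p) ^ ((k choose 2) - (l choose 2))"
    using assms(4) by (simp add: overlap_bound_def r_def)
  ultimately have le: "overlap_bound l \<le> ?K ^ r * ((1 - p) powr (3 / 4 * real k)) ^ r"
    by (simp only:)
  have "real ((k choose l) * ((n - k) choose r)) * overlap_bound l
      \<le> (real k ^ r * real n ^ r) * (?K ^ r * ((1 - p) powr (3 / 4 * real k)) ^ r)"
    by (rule mult_mono[OF chooses le]) (simp_all add: overlap_bound_nonneg)
  also have "\<dots> = near_ratio p n k \<Delta> ^ r"
    unfolding near_ratio_def power_mult_distrib by (simp only: mult_ac)
  finally show ?thesis by (simp add: r_def)
qed

text \<open>The term \<open>l = 0\<close> gives the mean, the other distant terms at most \<open>far_ratio\<close> times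
  as much each, and every near term at most \<open>1\<close>.\<close>
lemma sum_overlap_bound_le:
  assumes S: "S \<subseteq> {1..n}" "card S = k" and "3 \<le> k" "far_ratio p n k \<Delta> \<le> 1" "near_ratio p n k \<Delta> \<le> 1"
  shows "(\<Sum>S'\<in>{S'. S' \<subseteq> {1..n} \<and> card S' = k}. overlap_bound (card (S \<inter> S')))
    \<le> mean_count * (1 + real k * far_ratio p n k \<Delta>) + (real k + 1)"
proof -
  let ?I = "{S'. S' \<subseteq> {1..n} \<and> card S' = k}"
  have kn: "k \<le> n" "0 < n" using card_mono[of "{1..n}" S] S assms(3) by auto
  have far0: "0 \<le> far_ratio p n k \<Delta>" and near0: "0 \<le> near_ratio p n k \<Delta>" and mean0: "0 \<le> mean_count"
    using p hit_prob_nonneg by (simp_all add: far_ratio_def near_ratio_def mean_count_def)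
  have img: "(\<lambda>S'. card (S \<inter> S')) ` ?I \<subseteq> {..k}"
    using card_mono[OF finite_S[OF S], of "S \<inter> _"] S by (auto simp del: card_mono)
  have "(\<Sum>S'\<in>?I. overlap_bound (card (S \<inter> S')))
      = (\<Sum>l\<le>k. \<Sum>S'\<in>{S'\<in>?I. card (S \<inter> S') = l}. overlap_bound (card (S \<inter> S')))"
    using img by (subst sum.group) auto
  also have "\<dots> = (\<Sum>l\<le>k. real (card {S'\<in>?I. card (S \<inter> S') = l}) * overlap_bound l)"
    by (intro sum.cong refl) simp
  also have "\<dots> \<le> (\<Sum>l\<le>k. (if l = 0 then mean_count else mean_count * far_ratio p n k \<Delta>) + 1)"
  proof (intro sum_mono)
    fix l assume "l \<in> {..k}"
    then have lk: "l \<le> k" by simp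
    have "{S'\<in>?I. card (S \<inter> S') = l} = {S'. S' \<subseteq> {1..n} \<and> card S' = k \<and> card (S \<inter> S') = l}"
      by auto
    then have "real (card {S'\<in>?I. card (S \<inter> S') = l}) \<le> real ((k choose l) * ((n - k) choose (k - l)))"
      using card_subsets_with_overlap_le[OF _ S(1,2) _ lk, of n] by (simp del: of_nat_mult)
    then have "real (card {S'\<in>?I. card (S \<inter> S') = l}) * overlap_bound l
        \<le> real ((k choose l) * ((n - k) choose (k - l))) * overlap_bound l"
      using overlap_bound_nonneg by (rule mult_right_mono)
    also have "\<dots> \<le> (if l = 0 then mean_count else mean_count * far_ratio p n k \<Delta>) + 1"
    proof (cases "4 * l \<le> 3 * k")
      case True
      have "far_ratio p n k \<Delta> ^ l \<le> (if l = 0 then 1 else far_ratio p n k \<Delta>)"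
        using far0 assms(4) power_decreasing[of 1 l "far_ratio p n k \<Delta>"] by simp
      then have "mean_count * far_ratio p n k \<Delta> ^ l \<le> mean_count * (if l = 0 then 1 else far_ratio p n k \<Delta>)"
        using mean0 by (rule mult_left_mono)
      then show ?thesis using far_term_le[OF kn True] by (simp split: if_splits)
    next
      case False
      then have "real ((k choose l) * ((n - k) choose (k - l))) * overlap_bound l \<le> 1"
        using near_term_le[OF assms(3) kn(1) lk] power_le_one[OF near0 assms(5), of "k - l"] by linarith
      moreover have "0 \<le> (if l = 0 then mean_count else mean_count * far_ratio p n k \<Delta>)"
        using mean0 far0 by simp
      ultimately show ?thesis by linarith
    qed
    finally show "real (card {S'\<in>?I. card (S \<inter> S') = l}) * overlap_bound l
        \<le> (if l = 0 then mean_count else mean_count * far_ratio p n k \<Delta>) + 1" .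
  qed
  also have "\<dots> = mean_count * (1 + real k * far_ratio p n k \<Delta>) + (real k + 1)"
    by (simp add: sum.distrib sum.atMost_shift lessThan_atLeast0 algebra_simps)
  finally show ?thesis .
qed

lemma prob_no_hit_le:
  assumes "3 \<le> k" "far_ratio p n k \<Delta> \<le> 1" "near_ratio p n k \<Delta> \<le> 1" "0 < mean_count"
  shows "measure_pmf.prob M (- (\<Union>S\<in>{S. S \<subseteq> {1..n} \<and> card S = k}. hit S))
    \<le> real k * far_ratio p n k \<Delta> + (real k + 1) / mean_count"
proof (rule second_moment_bound)
  let ?I = "{S. S \<subseteq> {1..n} \<and> card S = k}"
  show "finite ?I" by simp
  show mean: "mean_count = (\<Sum>S\<in>?I. measure_pmf.prob M (hit S))"
    by (simp add: prob_hit n_subsets mean_count_def)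
  show "0 < mean_count" by fact
  let ?B = "mean_count * (1 + real k * far_ratio p n k \<Delta>) + (real k + 1)"
  have "(\<Sum>S\<in>?I. \<Sum>S'\<in>?I. measure_pmf.prob M (hit S \<inter> hit S'))
      \<le> (\<Sum>S\<in>?I. \<Sum>S'\<in>?I. hit_prob * overlap_bound (card (S \<inter> S')))"
    using prob_hit_both_overlap by (intro sum_mono) auto
  also have "\<dots> \<le> (\<Sum>S\<in>?I. hit_prob * ?B)"
    unfolding sum_distrib_left[symmetric]
    using sum_overlap_bound_le[OF _ _ assms(1-3)] hit_prob_nonneg by (intro sum_mono mult_left_mono) auto
  also have "\<dots> = mean_count * ?B" by (simp add: n_subsets mean_count_def)
  also have "\<dots> = (1 + (real k * far_ratio p n k \<Delta> + (real k + 1) / mean_count)) * mean_count\<^sup>2"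
    using assms(4) by (simp add: field_simps power2_eq_square)
  finally show "(\<Sum>S\<in>?I. \<Sum>S'\<in>?I. measure_pmf.prob M (hit S \<inter> hit S'))
      \<le> (1 + (real k * far_ratio p n k \<Delta> + (real k + 1) / mean_count)) * mean_count\<^sup>2" .
qed

end

section \<open>Factorials and binomial coefficients\<close>

lemma power_self_le_fact_exp: "real k ^ k \<le> fact k * exp (real k)"
proof (induction k)
  case (Suc k)
  show ?case
  proof (cases "k = 0")
    case False
    have "(1 + 1 / real k) ^ k \<le> exp 1"
      using exp_ge_one_plus_x_over_n_power_n[of k 1] False by simp
    then have "(1 + 1 / real k) ^ k * real k ^ k \<le> exp 1 * real k ^ k"
      by (rule mult_right_mono) simp
    also have "(1 + 1 / real k) ^ k * real k ^ k = real (Suc k) ^ k"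
      using False by (simp add: power_mult_distrib[symmetric] field_simps)
    also have "exp 1 * real k ^ k \<le> exp 1 * (fact k * exp (real k))"
      using Suc.IH by simp
    finally have "real (Suc k) * real (Suc k) ^ k \<le> real (Suc k) * (exp 1 * (fact k * exp (real k)))"
      by (rule mult_left_mono) simp
    then show ?thesis by (simp add: exp_add algebra_simps)
  qed simp
qed simp

text \<open>Stirling's upper bound in the form that shows how little is lost by layers of size \<open>s\<close>: the
  factor \<open>s ^ s / fact s\<close> per layer falls short of \<open>exp s\<close> by a factor of order \<open>s\<close> only.\<close>
lemma fact_le_power_exp:
  assumes "0 < s"
  shows "fact s * exp (real s) \<le> exp 1 * real s * real s ^ s"
  using assms
proof (induction s rule: nat_induct_non_zero)
  case (Suc s)
  define S where "S = real (Suc s)"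
  have S: "0 < S" "S = real s + 1" by (simp_all add: S_def)
  have "(1 + (- 1) / S) ^ Suc s \<le> exp (- 1)"
    unfolding S_def by (rule exp_ge_one_plus_x_over_n_power_n) simp_all
  also have "1 + (- 1) / S = real s / S" using S by (simp add: field_simps)
  finally have "exp 1 * (real s ^ Suc s / S ^ Suc s) \<le> exp 1 * exp (- 1)"
    unfolding power_divide by (rule mult_left_mono) simp
  then have "exp 1 * real s ^ Suc s / S ^ Suc s \<le> 1"
    by (simp only: exp_add[symmetric] add.right_inverse exp_zero times_divide_eq_right)
  then have step: "exp 1 * (real s * real s ^ s) \<le> real (Suc s) ^ Suc s"
    using zero_less_power[OF S(1), of "Suc s"] unfolding S_def[symmetric]
    by (simp only: divide_le_eq_1_pos power_Suc[of "real s"])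
  have "fact (Suc s) * exp (real (Suc s)) = real (Suc s) * exp 1 * (fact s * exp (real s))"
    by (simp add: exp_add algebra_simps)
  also have "\<dots> \<le> real (Suc s) * exp 1 * (exp 1 * real s * real s ^ s)"
    using Suc.IH by (intro mult_left_mono) simp_all
  also have "\<dots> = real (Suc s) * exp 1 * (exp 1 * (real s * real s ^ s))" by (simp only: mult_ac)
  also have "\<dots> \<le> real (Suc s) * exp 1 * real (Suc s) ^ Suc s"
    using step by (intro mult_left_mono) simp_all
  also have "\<dots> = exp 1 * real (Suc s) * real (Suc s) ^ Suc s" by (simp only: mult_ac)
  finally show ?case .
qed simp

lemma fact_binomial_ge:
  assumes "k \<le> n"
  shows "real (n - k) ^ k \<le> fact k * real (n choose k)"
proof -
  have "real (n - k) ^ j \<le> fact j * real (n choose j)" if "j \<le> k" for j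
    using that
  proof (induction j)
    case (Suc j)
    have "Suc j * (n choose Suc j) = (n - j) * (n choose j)"
      by (simp only: binomial_absorption binomial_absorb_comp)
    then have "real (Suc j) * real (n choose Suc j) = real (n - j) * real (n choose j)"
      by (metis of_nat_mult)
    then have "fact (Suc j) * real (n choose Suc j) = real (n - j) * (fact j * real (n choose j))"
      unfolding fact_Suc by (metis mult.assoc mult.left_commute)
    moreover have "real (n - k) * real (n - k) ^ j \<le> real (n - j) * (fact j * real (n choose j))"
      using Suc by (intro mult_mono) simp_all
    ultimately show ?case by (simp only: power_Suc)
  qed simp
  then show ?thesis by simp
qed

text \<open>For \<open>k\<close> below the order of the square root of \<open>n\<close>, sampling with and without replacement agree up
  to a constant factor, by Bernoulli's inequality.\<close>
lemma fact_binomial_ge_half: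
  assumes "2 * real k ^ 2 \<le> real n" "0 < n"
  shows "real n ^ k / 2 \<le> fact k * real (n choose k)"
proof -
  have "real k * 1 \<le> real k * real k" by (cases k) simp_all
  then have "real k \<le> real n" using assms(1) by (simp add: power2_eq_square)
  then have kn: "k \<le> n" by simp
  have "1 / 2 \<le> 1 + real k * (- (real k / real n))"
    using assms by (simp add: field_simps power2_eq_square)
  also have "\<dots> \<le> (1 + - (real k / real n)) ^ k"
    using \<open>real k \<le> real n\<close> assms(2) by (intro Bernoulli_inequality) simp
  also have "1 + - (real k / real n) = real (n - k) / real n"
    using kn assms(2) by (simp add: field_simps of_nat_diff)
  finally have "real n ^ k / 2 \<le> real (n - k) ^ k"
    using assms(2) by (simp add: power_divide field_simps)
  then show ?thesis using fact_binomial_ge[OF kn] by linarith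
qed

text \<open>Stirling turns \<open>(n choose k) * k ^ k\<close> into \<open>(exp 1 * n) ^ k\<close>, and \<open>(1 + 1 / (k * \<theta>)) ^ k\<close> stays
  below \<open>exp (1 / \<theta>)\<close>.\<close>
lemma first_moment_estimate:
  fixes q \<theta> :: real
  assumes lam: "0 < \<theta>" and q: "0 < q" and k: "0 < k"
  shows "real (n choose k) * (q ^ (k choose 2) * (1 + real k * \<theta>) ^ k)
    \<le> exp (1 / \<theta>) * (exp 1 * real n * \<theta> * q powr ((real k - 1) / 2)) ^ k"
proof -
  have "real ((n choose k) * fact k) \<le> real (n ^ k)"
    using binomial_fact_pow[of n k] by (rule of_nat_mono)
  then have nk: "real (n choose k) * fact k \<le> real n ^ k"
    by (simp only: of_nat_mult of_nat_fact of_nat_power)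
  have ek: "exp (real k) = exp 1 ^ k" using exp_of_nat_mult[of k "1 :: real"] by simp
  have "real (n choose k) * real k ^ k \<le> real (n choose k) * (fact k * exp (real k))"
    using power_self_le_fact_exp by (rule mult_left_mono) simp
  also have "\<dots> = (real (n choose k) * fact k) * exp 1 ^ k" unfolding ek by (simp only: mult_ac)
  also have "\<dots> \<le> real n ^ k * exp 1 ^ k" using nk by (rule mult_right_mono) simp
  finally have c: "real (n choose k) * real k ^ k \<le> (exp 1 * real n) ^ k"
    by (simp only: power_mult_distrib mult.commute)
  have "(1 + (1 / \<theta>) / real k) ^ k \<le> exp (1 / \<theta>)"
  proof (rule exp_ge_one_plus_x_over_n_power_n)
    have "0 < 1 / \<theta>" using lam by simp
    then show "- real k \<le> 1 / \<theta>" by linarith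
  qed (rule k)
  then have "(real k * \<theta>) ^ k * (1 + (1 / \<theta>) / real k) ^ k \<le> (real k * \<theta>) ^ k * exp (1 / \<theta>)"
    using lam by (intro mult_left_mono zero_le_power) simp_all
  moreover have "1 + real k * \<theta> = real k * \<theta> * (1 + (1 / \<theta>) / real k)"
    using lam k by (simp add: field_simps)
  ultimately have l: "(1 + real k * \<theta>) ^ k \<le> (real k * \<theta>) ^ k * exp (1 / \<theta>)"
    by (simp only: power_mult_distrib)
  have qq: "q ^ (k choose 2) = (q powr ((real k - 1) / 2)) ^ k"
  proof -
    have e: "real (k choose 2) = (real k - 1) / 2 * real k" unfolding real_choose_two by simp
    have "q ^ (k choose 2) = q powr real (k choose 2)" using powr_realpow[OF q] by simp
    then show ?thesis unfolding e powr_mult_of_nat[OF q] .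
  qed
  have "real (n choose k) * (q ^ (k choose 2) * (1 + real k * \<theta>) ^ k)
      \<le> real (n choose k) * (q ^ (k choose 2) * ((real k * \<theta>) ^ k * exp (1 / \<theta>)))"
    using l q by (intro mult_left_mono zero_le_power) simp_all
  also have "\<dots> = (real (n choose k) * real k ^ k) * (\<theta> ^ k * exp (1 / \<theta>) * q ^ (k choose 2))"
    unfolding power_mult_distrib by (simp only: mult_ac)
  also have "\<dots> \<le> (exp 1 * real n) ^ k * (\<theta> ^ k * exp (1 / \<theta>) * q ^ (k choose 2))"
    using c by (rule mult_right_mono) (intro mult_nonneg_nonneg zero_le_power, use q lam in simp_all)
  also have "\<dots> = exp (1 / \<theta>) * (exp 1 * real n * \<theta> * q powr ((real k - 1) / 2)) ^ k"
    unfolding qq power_mult_distrib by (simp only: mult_ac)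
  finally show ?thesis .
qed

section \<open>The number of induced layered forests\<close>

text \<open>The number of layered forests depends only on the sizes of the sets, so initial segments of the
  natural numbers can represent them.\<close>
definition layered_forest_count :: "nat \<Rightarrow> nat \<Rightarrow> nat \<Rightarrow> nat" where
  "layered_forest_count s M k = card (layered_forests s M {..<k} {..<s})"

lemma layered_forest_count_mult:
  assumes "s + s * M \<le> k"
  shows "layered_forest_count s M k * fact s ^ M * fact (k - s - s * M) = fact (k - s) * s ^ (s * M)"
proof -
  have "{..<k} - {..<s} = {s..<k}" by auto
  then have "card ({..<k} - {..<s}) = k - s" by simp
  then show ?thesis
    using card_layered_forests[of "{..<k}" "{..<s}" s M] assms
    by (simp add: layered_forest_count_def)
qed

lemma card_layered_forests_eq_count:
  assumes "finite S" "R \<subseteq> S" "card R = s" "card S = k" "s + s * M \<le> k"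
  shows "card (layered_forests s M S R) = layered_forest_count s M k"
proof -
  let ?d = "fact s ^ M * fact (k - s - s * M) :: nat"
  have "card (S - R) = k - s" using assms by (metis card_Diff_subset finite_subset)
  then have "card (layered_forests s M S R) * ?d = fact (k - s) * s ^ (s * M)"
    using card_layered_forests[OF assms(1-3), of M] assms(5) by (simp add: mult.assoc)
  also have "\<dots> = layered_forest_count s M k * ?d"
    using layered_forest_count_mult[OF assms(5)] by (simp add: mult.assoc)
  finally show ?thesis by simp
qed

lemma layered_forest_count_ge:
  assumes "s + s * M \<le> k" "k < 2 * s + s * M"
  shows "fact k * s ^ (s * M) \<le> layered_forest_count s M k * fact s ^ M * (fact s * k ^ s)"
proof -
  let ?t = "k - s - s * M"
  have "fact k div fact (k - s) \<le> k ^ s" using assms(1) by (intro fact_div_fact_le_pow) simp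
  then have "fact k div fact (k - s) * fact (k - s) \<le> k ^ s * fact (k - s)"
    by (rule mult_right_mono) simp
  moreover have "fact (k - s) dvd (fact k :: nat)" by (intro fact_dvd) simp
  ultimately have "fact k \<le> k ^ s * fact (k - s)" by (simp only: dvd_div_mult_self)
  then have "fact k * s ^ (s * M) \<le> k ^ s * fact (k - s) * s ^ (s * M)"
    by (rule mult_right_mono) simp
  also have "\<dots> = k ^ s * (layered_forest_count s M k * fact s ^ M * fact ?t)"
    unfolding layered_forest_count_mult[OF assms(1)] by (simp only: mult_ac)
  also have "\<dots> \<le> k ^ s * (layered_forest_count s M k * fact s ^ M * fact s)"
    using assms(2) by (intro mult_left_mono fact_mono_nat) simp_all
  finally show ?thesis by (simp only: mult_ac)
qed

text \<open>The expected number of induced layered forests has the same exponential growth as the first moment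
  bound \<open>first_moment_estimate\<close>, with the base diminished by the factor \<open>\<beta>\<close> alone. The layer size
  \<open>s\<close> has to be so large that \<open>fact s * (exp 1 * \<beta>) ^ s \<le> s ^ s\<close>, which is possible for every \<open>\<beta> < 1\<close>. The factor \<open>max 1 y\<close>
  accounts for the fewer than \<open>2 * s\<close> edges by which a layered forest falls short of \<open>k\<close>.\<close>
lemma layered_mean_ge:
  fixes q \<theta> \<beta> :: real
  assumes pos: "0 < q" "0 < \<theta>" "0 < \<beta>" and n: "0 < n" "2 * real k ^ 2 \<le> real n"
    and k: "0 < k" "s + s * M \<le> k" "k < 2 * s + s * M"
    and dense: "fact s * (exp 1 * \<beta>) ^ s \<le> real s ^ s"
  defines "y \<equiv> exp 1 * \<beta> * \<theta>"
  shows "(real n * y * q powr ((real k - 1) / 2)) ^ k / (2 * fact s * max 1 y ^ (2 * s) * real k ^ s)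
    \<le> real (n choose k) * (real (layered_forest_count s M k) * (\<theta> ^ (s * M) * q ^ (k choose 2)))"
proof -
  let ?L = "real (layered_forest_count s M k)" and ?C = "real (n choose k)"
  have y: "0 < y" using pos by (simp add: y_def)
  have c1: "real n ^ k \<le> 2 * (fact k * ?C)"
    using fact_binomial_ge_half[OF n(2,1)] by simp
  have "real (fact k * s ^ (s * M)) \<le> real (layered_forest_count s M k * fact s ^ M * (fact s * k ^ s))"
    using layered_forest_count_ge[OF k(2,3)] by (rule of_nat_mono)
  then have c2: "fact k * real s ^ (s * M) \<le> ?L * fact s ^ M * (fact s * real k ^ s)"
    by (simp only: of_nat_mult of_nat_power of_nat_fact)
  have "(fact s * (exp 1 * \<beta>) ^ s) ^ M \<le> (real s ^ s) ^ M"
    using dense pos by (intro power_mono) simp_all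
  then have "fact s ^ M * (exp 1 * \<beta>) ^ (s * M) \<le> real s ^ (s * M)"
    by (simp only: power_mult_distrib power_mult)
  then have "fact k * (fact s ^ M * (exp 1 * \<beta>) ^ (s * M)) \<le> fact k * real s ^ (s * M)"
    by (rule mult_left_mono) simp
  also note c2
  finally have "fact s ^ M * (fact k * (exp 1 * \<beta>) ^ (s * M)) \<le> fact s ^ M * (?L * (fact s * real k ^ s))"
    by (simp only: mult_ac)
  then have c3: "fact k * (exp 1 * \<beta>) ^ (s * M) \<le> ?L * (fact s * real k ^ s)"
    by (rule mult_left_le_imp_le) simp
  have "y ^ k = y ^ (s * M) * y ^ (k - s * M)" using k(2) by (simp add: power_add[symmetric])
  also have "y ^ (k - s * M) \<le> max 1 y ^ (k - s * M)" using y by (intro power_mono) auto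
  also have "max 1 y ^ (k - s * M) \<le> max 1 y ^ (2 * s)" using k(3) by (intro power_increasing) auto
  finally have c4: "y ^ k \<le> y ^ (s * M) * max 1 y ^ (2 * s)" using y by simp
  have qq: "(q powr ((real k - 1) / 2)) ^ k = q ^ (k choose 2)"
  proof -
    have e: "real (k choose 2) = (real k - 1) / 2 * real k" unfolding real_choose_two by simp
    have "q ^ (k choose 2) = q powr real (k choose 2)" using powr_realpow[OF pos(1)] by simp
    then show ?thesis unfolding e powr_mult_of_nat[OF pos(1)] by simp
  qed
  let ?Q = "q ^ (k choose 2)" and ?Y = "max 1 y ^ (2 * s)"
  have pos': "0 < ?Q" "0 < ?Y" using pos by simp_all
  have "fact k * (real n ^ k * y ^ k) \<le> fact k * (2 * (fact k * ?C) * (y ^ (s * M) * ?Y))"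
    using c1 c4 y by (intro mult_left_mono mult_mono) simp_all
  also have "\<dots> = 2 * fact k * ?C * \<theta> ^ (s * M) * ?Y * (fact k * (exp 1 * \<beta>) ^ (s * M))"
    unfolding y_def power_mult_distrib by (simp only: mult_ac)
  also have "\<dots> \<le> 2 * fact k * ?C * \<theta> ^ (s * M) * ?Y * (?L * (fact s * real k ^ s))"
    using c3 by (rule mult_left_mono) (use pos pos' in simp)
  finally have "fact k * (real n ^ k * y ^ k)
      \<le> fact k * (?C * (?L * \<theta> ^ (s * M)) * (2 * fact s * ?Y * real k ^ s))"
    by (simp only: mult_ac)
  then have "real n ^ k * y ^ k \<le> ?C * (?L * \<theta> ^ (s * M)) * (2 * fact s * ?Y * real k ^ s)"
    by (rule mult_left_le_imp_le) simp
  then have "real n ^ k * y ^ k * ?Q \<le> ?C * (?L * \<theta> ^ (s * M)) * (2 * fact s * ?Y * real k ^ s) * ?Q"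
    by (rule mult_right_mono) (use pos' in simp)
  also have "real n ^ k * y ^ k * ?Q = (real n * y * q powr ((real k - 1) / 2)) ^ k"
    unfolding power_mult_distrib qq ..
  finally have main: "(real n * y * q powr ((real k - 1) / 2)) ^ k
      \<le> ?C * (?L * (\<theta> ^ (s * M) * ?Q)) * (2 * fact s * ?Y * real k ^ s)"
    by (simp only: mult_ac)
  have "0 < 2 * fact s * ?Y * real k ^ s" using pos' k(1) by simp
  then show ?thesis using main by (simp only: pos_divide_le_eq)
qed

text \<open>The second moment bound for layered forests, with an arbitrary root layer fixed in every vertex
  set. All of them have \<open>s * M\<close> edges and degrees at most \<open>s + 1\<close>.\<close>
lemma prob_max_induced_forest_less_le:
  fixes p :: real
  assumes p: "0 < p" "p < 1" and k: "3 \<le> k" "s + s * M \<le> k" and s: "0 < s"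
    and far: "far_ratio p n k (s + 1) \<le> 1"
    and near: "near_ratio p n k (s + 1) \<le> 1"
    and mean: "\<mu> = real (n choose k) * (real (layered_forest_count s M k)
      * ((p / (1 - p)) ^ (s * M) * (1 - p) ^ (k choose 2)))" "0 < \<mu>"
  shows "measure_pmf.prob (binomial_random_graph n p) {G. max_induced_forest_size G < k}
    \<le> real k * far_ratio p n k (s + 1) + (real k + 1) / \<mu>"
proof -
  define root where "root = (\<lambda>S :: nat set. SOME R. R \<subseteq> S \<and> card R = s)"
  define \<F> where "\<F> = (\<lambda>S. layered_forests s M S (root S))"
  have root: "root S \<subseteq> S \<and> card (root S) = s" if "card S = k" for S
  proof -
    have "s \<le> card S" using that k(2) by simp
    then obtain R where "R \<subseteq> S" "card R = s" by (meson obtain_subset_with_card_n)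
    then show ?thesis unfolding root_def by (intro someI[of "\<lambda>R. R \<subseteq> S \<and> card R = s" R]) simp
  qed
  have fin: "finite S" if "S \<subseteq> {1..n}" for S :: "nat set" using that finite_subset by blast
  interpret bounded_degree_family p n k "s * M" "s + 1" "layered_forest_count s M k" \<F>
  proof
    fix S :: "nat set" assume S: "S \<subseteq> {1..n}" "card S = k"
    note R = conjunct1[OF root[OF S(2)]] conjunct2[OF root[OF S(2)]]
    show "card (\<F> S) = layered_forest_count s M k"
      unfolding \<F>_def by (rule card_layered_forests_eq_count[OF fin[OF S(1)] R S(2) k(2)])
    fix F assume F: "F \<in> \<F> S"
    then have F': "F \<in> layered_forests s M S (root S)" by (simp add: \<F>_def)
    show "F \<subseteq> vertex_pairs S" by (rule layered_forests_edges[OF R(1) F'])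
    show "card F = s * M" by (rule card_layered_forest[OF fin[OF S(1)] R(1) F'])
    fix v
    show "card {e \<in> F. v \<in> e} \<le> s + 1"
      using layered_forest_degree[OF fin[OF S(1)] R(1) F', of v] by (simp split: if_splits)
  qed (use p in auto)
  have "s * M \<le> k choose 2"
  proof -
    have "s * M \<le> k - 1" using k(2) s by linarith
    also have "k - 1 \<le> (k choose 2)"
    proof -
      have "(real k - 1) * 2 \<le> (real k - 1) * real k" using k(1) by (intro mult_left_mono) simp_all
      then have "real (k - 1) \<le> real (k choose 2)"
        unfolding real_choose_two using k(1) by (simp add: of_nat_diff algebra_simps)
      then show ?thesis by simp
    qed
    finally show ?thesis .
  qed
  then have "p ^ (s * M) * (1 - p) ^ ((k choose 2) - s * M)
      = (p / (1 - p)) ^ (s * M) * (1 - p) ^ (k choose 2)"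
    using p by (subst power_diff) (simp_all only: power_divide, simp_all)
  then have mc: "mean_count = \<mu>" unfolding mean(1) mean_count_def hit_prob_def by simp
  have "measure_pmf.prob M' {G. max_induced_forest_size G < k}
      \<le> measure_pmf.prob M' (- (\<Union>S\<in>{S. S \<subseteq> {1..n} \<and> card S = k}. hit S))"
    if M': "M' = binomial_random_graph n p" for M'
  proof -
    have "measure_pmf.prob M' {G. max_induced_forest_size G < k}
        = measure_pmf.prob M' ({G. max_induced_forest_size G < k} \<inter> set_pmf M')"
      by (simp add: measure_Int_set_pmf)
    also have "\<dots> \<le> measure_pmf.prob M' (- (\<Union>S\<in>{S. S \<subseteq> {1..n} \<and> card S = k}. hit S))"
    proof (intro measure_pmf.finite_measure_mono subsetI ComplI)
      fix G assume G: "G \<in> {G. max_induced_forest_size G < k} \<inter> set_pmf M'"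
        and "G \<in> (\<Union>S\<in>{S. S \<subseteq> {1..n} \<and> card S = k}. hit S)"
      then obtain S where S: "S \<subseteq> {1..n}" "card S = k" and "G \<in> hit S" by blast
      then have "edges G \<inter> vertex_pairs S \<in> \<F> S" by (simp add: hit_def)
      then have "edges G \<inter> vertex_pairs S \<in> layered_forests s M S (root S)" by (simp only: \<F>_def)
      then have "forest (S, edges G \<inter> vertex_pairs S)"
        using layered_forest_is_forest[OF fin[OF S(1)] conjunct1[OF root[OF S(2)]]] by simp
      moreover have "simple_graph G" "verts G = {1..n}"
        using G M' simple_graph_binomial_random_graph[of G n p] by simp_all
      ultimately have "k \<le> max_induced_forest_size G"
        using max_induced_forest_size_ge_iff[of G k] S by auto
      then show False using G by simp
    qed simp
    finally show ?thesis .
  qed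
  from this[OF refl] show ?thesis
    using prob_no_hit_le[OF k(1) far near] mean(2) unfolding mc by linarith
qed

section \<open>Tail bounds and concentration\<close>

lemma dense_layer_size_exists:
  fixes \<beta> :: real
  assumes "0 < \<beta>" "\<beta> < 1"
  shows "\<exists>s>0. fact s * (exp 1 * \<beta>) ^ s \<le> real s ^ s"
proof -
  have "(\<lambda>s. exp 1 * real s * \<beta> ^ s) \<longlonglongrightarrow> 0" using assms by real_asymp
  then have "\<forall>\<^sub>F s in sequentially. exp 1 * real s * \<beta> ^ s < 1"
    by (rule order_tendstoD) simp
  then have "\<forall>\<^sub>F s in sequentially. 0 < s \<and> exp 1 * real s * \<beta> ^ s < 1"
    using eventually_gt_at_top[of 0] by eventually_elim simp
  then obtain s where s: "0 < s" "exp 1 * real s * \<beta> ^ s < 1"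
    using eventually_happens' sequentially_bot by blast
  have es: "exp (real s) = exp 1 ^ s" using exp_of_nat_mult[of s "1 :: real"] by simp
  have "fact s * (exp 1 * \<beta>) ^ s = (fact s * exp (real s)) * \<beta> ^ s"
    unfolding es power_mult_distrib by (simp only: mult_ac)
  also have "\<dots> \<le> (exp 1 * real s * real s ^ s) * \<beta> ^ s"
    using fact_le_power_exp[OF s(1)] assms by (intro mult_right_mono zero_le_power) simp_all
  also have "\<dots> = (exp 1 * real s * \<beta> ^ s) * real s ^ s" by (simp only: mult_ac)
  also have "\<dots> \<le> 1 * real s ^ s"
    using s(2) by (intro mult_right_mono zero_le_power) simp_all
  finally show ?thesis using s(1) by auto
qed

text \<open>The mean is at least of order \<open>k ^ (- s) * \<beta> ^ (- k)\<close> when \<open>k \<le> x + 5 / 2\<close>: being below the threshold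
  \<open>x + 3\<close> by \<open>1 / 2\<close> gives a base \<open>(1 - p) powr (- 1 / 4) = \<beta> powr (- 2)\<close>, of which the layered
  forests spend one factor \<open>\<beta>\<close>. The bound depends on \<open>n\<close> through \<open>k\<close> alone, since \<open>n\<close> and
  \<open>(1 - p) powr (- k / 2)\<close> agree up to constant factors.\<close>
lemma lower_tail:
  fixes p :: real
  assumes p: "0 < p" "p < 1"
  shows "\<exists>g. g \<longlonglongrightarrow> 0 \<and> (\<forall>\<^sub>F k in sequentially. \<forall>n x.
    0 < n \<longrightarrow> (1 - p) powr (x / 2) * (exp 1 * real n * p) = 1 \<longrightarrow> x \<le> real k \<longrightarrow> real k \<le> x + 5 / 2 \<longrightarrow>
    measure_pmf.prob (binomial_random_graph n p) {G. max_induced_forest_size G < k} \<le> g k)"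
proof -
  define q where "q = 1 - p"
  define \<theta> where "\<theta> = p / q"
  \<comment> \<open>All errors are measured in powers of \<open>\<beta>\<close>; in particular \<open>q powr (k / 2) = \<beta> ^ (4 * k)\<close>.\<close>
  define \<beta> where "\<beta> = q powr (1 / 8)"
  have q: "0 < q" "q < 1" using p by (simp_all add: q_def)
  have th: "0 < \<theta>" using p q by (simp add: \<theta>_def)
  have \<beta>: "0 < \<beta>" "\<beta> < 1" using q powr_less_mono2[of "1 / 8" q 1] by (simp_all add: \<beta>_def)
  obtain s where s: "0 < s" and dense: "fact s * (exp 1 * \<beta>) ^ s \<le> real s ^ s"
    using dense_layer_size_exists[OF \<beta>] by blast
  define y where "y = exp 1 * \<beta> * \<theta>"
  \<comment> \<open>\<open>1 / n\<close> is at most \<open>A * q powr (k / 2)\<close> when \<open>k \<le> x + 5 / 2\<close>.\<close>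
  define A where "A = exp 1 * p * q powr (- (5 / 4))"
  define Cf where "Cf = A / p ^ (s + 1)"
  define c where "c = 2 * fact s * max 1 y ^ (2 * s)"
  define g where "g = (\<lambda>k. real k * (Cf * real k ^ 2 * \<beta> ^ k) + (real k + 1) * (c * real k ^ s * \<beta> ^ k))"
  have A: "0 < A" using p q by (simp add: A_def)
  have c: "0 < c" by (simp add: c_def)
  have small: "\<forall>\<^sub>F k in sequentially. f k \<le> 1" if "f \<longlonglongrightarrow> 0" for f :: "nat \<Rightarrow> real"
    using order_tendstoD(2)[OF that, of 1] by (auto elim: eventually_mono)
  have "\<forall>\<^sub>F k in sequentially. max 3 s \<le> k" by (rule eventually_ge_at_top)
  moreover have "\<forall>\<^sub>F k in sequentially. Cf * real k ^ 2 * \<beta> ^ k \<le> 1"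
    by (rule small) (use \<beta> in real_asymp)
  moreover have "\<forall>\<^sub>F k in sequentially.
      real k / (exp 1 * p) * ((real k ^ 2 + 1) / q) ^ (s + 1) * \<beta> ^ k \<le> 1"
    by (rule small) (use \<beta> q p in real_asymp)
  moreover have "\<forall>\<^sub>F k in sequentially. 2 * real k ^ 2 * A * \<beta> ^ k \<le> 1"
    by (rule small) (use \<beta> in real_asymp)
  ultimately have "\<forall>\<^sub>F k in sequentially. \<forall>n x.
    0 < n \<longrightarrow> (1 - p) powr (x / 2) * (exp 1 * real n * p) = 1 \<longrightarrow> x \<le> real k \<longrightarrow> real k \<le> x + 5 / 2 \<longrightarrow>
    measure_pmf.prob (binomial_random_graph n p) {G. max_induced_forest_size G < k} \<le> g k"
  proof eventually_elim
    case (elim k)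
    show ?case
    proof (intro allI impI)
      fix n :: nat and x :: real
      assume n: "0 < n" and x0: "(1 - p) powr (x / 2) * (exp 1 * real n * p) = 1"
        and x: "x \<le> real k" "real k \<le> x + 5 / 2"
      define b where "b = \<beta> ^ k"
      define w where "w = q powr (x / 2)"
      have k: "3 \<le> k" "s \<le> k" using elim(1) by simp_all
      have b: "0 < b" "b \<le> 1" using \<beta> by (simp_all add: b_def power_le_one)
      have bj: "b ^ Suc j \<le> b" for j using b by (simp add: mult_left_le power_le_one)
      have qb: "q powr (real j / 8 * real k) = b ^ j" for j
      proof -
        have "q powr (real j / 8 * real k) = q powr (1 / 8 * real (k * j))"
          by (simp add: mult.commute)
        also have "\<dots> = b ^ j" unfolding powr_mult_of_nat[OF q(1)] b_def \<beta>_def power_mult ..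
        finally show ?thesis .
      qed
      have inv_n: "1 / real n = exp 1 * p * w" using x0 n by (simp add: w_def q_def field_simps)
      have w_le: "w \<le> b ^ 4 * q powr (- (5 / 4))"
      proof -
        have "w \<le> q powr (real 4 / 8 * real k + - (5 / 4))"
          unfolding w_def using q x by (intro powr_mono') simp_all
        then show ?thesis unfolding powr_add qb .
      qed
      have w_ge: "b ^ 4 \<le> w"
      proof -
        have "q powr (real 4 / 8 * real k) \<le> w"
          unfolding w_def using q x by (intro powr_mono') simp_all
        then show ?thesis unfolding qb .
      qed
      have inv_n_le: "1 / real n \<le> A * b ^ 4"
      proof -
        have "exp 1 * p * w \<le> exp 1 * p * (b ^ 4 * q powr (- (5 / 4)))"
          using w_le p by (intro mult_left_mono) simp_all
        then show ?thesis unfolding inv_n A_def by (simp only: mult_ac)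
      qed
      have big: "2 * real k ^ 2 \<le> real n"
      proof -
        have "A * b ^ 4 \<le> A * b"
          using bj[of 3] A by (intro mult_left_mono) (simp_all add: eval_nat_numeral)
        then have "2 * real k ^ 2 * (1 / real n) \<le> 2 * real k ^ 2 * (A * b)"
          using inv_n_le by (intro mult_left_mono) simp_all
        also have "\<dots> \<le> 1" using elim(4) by (simp add: b_def mult.assoc)
        finally show ?thesis using n by (simp add: field_simps)
      qed
      have far: "far_ratio p n k (s + 1) \<le> Cf * real k ^ 2 * b"
      proof -
        have e3: "q powr (- (3 / 8 * real k)) = 1 / b ^ 3"
          unfolding powr_minus using qb[of 3] by (simp only: of_nat_numeral inverse_eq_divide)
        have "far_ratio p n k (s + 1)
            = real k ^ 2 / p ^ (s + 1) * (1 / real n) * (1 / b ^ 3)"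
          unfolding far_ratio_def q_def[symmetric] e3
          by (simp only: divide_inverse inverse_mult_distrib mult_1 mult_ac)
        also have "\<dots> \<le> real k ^ 2 / p ^ (s + 1) * (A * b ^ 4) * (1 / b ^ 3)"
          using inv_n_le p b by (intro mult_right_mono mult_left_mono) simp_all
        also have "\<dots> = Cf * real k ^ 2 * b"
        proof -
          have "b ^ 4 * (1 / b ^ 3) = b" using b by (simp add: eval_nat_numeral)
          then have "real k ^ 2 / p ^ (s + 1) * (A * (b ^ 4 * (1 / b ^ 3))) = Cf * real k ^ 2 * b"
            by (simp add: Cf_def)
          then show ?thesis by (simp only: mult.assoc)
        qed
        finally show ?thesis .
      qed
      have near: "near_ratio p n k (s + 1) \<le> 1"
      proof -
        have nb: "real n * b ^ 4 \<le> 1 / (exp 1 * p)"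
        proof -
          have "real n * b ^ 4 \<le> real n * w" using w_ge by (intro mult_left_mono) simp_all
          also have "\<dots> = 1 / (exp 1 * p)" using x0 p by (simp add: w_def q_def field_simps)
          finally show ?thesis .
        qed
        have "3 / 4 * real k = real 6 / 8 * real k" by simp
        then have e6: "q powr (3 / 4 * real k) = b ^ 6" using qb[of 6] by (simp only:)
        have b6: "b ^ 6 = b ^ 4 * b ^ 2" by (simp flip: power_add)
        have "near_ratio p n k (s + 1)
            = (real n * b ^ 4) * (real k * ((real k ^ 2 + 1) / q) ^ (s + 1) * b ^ 2)"
          unfolding near_ratio_def q_def[symmetric] e6 b6
          by (simp only: mult_ac)
        also have "\<dots> \<le> (1 / (exp 1 * p)) * (real k * ((real k ^ 2 + 1) / q) ^ (s + 1) * b)"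
          using nb bj[of 1] b p q
          by (intro mult_mono mult_left_mono) (simp_all add: numeral_2_eq_2)
        also have "\<dots> = real k / (exp 1 * p) * ((real k ^ 2 + 1) / q) ^ (s + 1) * b" by simp
        also have "\<dots> \<le> 1" using elim(3) by (simp only: b_def)
        finally show ?thesis .
      qed
      \<comment> \<open>As many layers of size \<open>s\<close> as fit.\<close>
      define M where "M = (k - s) div s"
      have M: "s + s * M \<le> k" "k < 2 * s + s * M"
      proof -
        have "s * M + (k - s) mod s = k - s" by (simp add: M_def)
        moreover have "(k - s) mod s < s" using s by simp
        ultimately show "s + s * M \<le> k" "k < 2 * s + s * M" using k by linarith+
      qed
      define \<mu> where "\<mu> = real (n choose k) * (real (layered_forest_count s M k)
          * (\<theta> ^ (s * M) * q ^ (k choose 2)))"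
      have base: "1 / \<beta> \<le> real n * y * q powr ((real k - 1) / 2)"
      proof -
        have qx: "w * q powr (3 / 4) \<le> q powr ((real k - 1) / 2)"
        proof -
          have "q powr (x / 2 + 3 / 4) \<le> q powr ((real k - 1) / 2)"
            using q x by (intro powr_mono') simp_all
          then show ?thesis by (simp add: w_def powr_add)
        qed
        have "q powr (3 / 4) * (\<beta> * \<beta>) = q powr (3 / 4 + (1 / 8 + 1 / 8))"
          unfolding \<beta>_def powr_add ..
        then have root: "q powr (3 / 4) * (\<beta> * \<beta>) = q" using q by simp
        have "1 / \<beta> = \<beta> * (q powr (3 / 4) / (q powr (3 / 4) * (\<beta> * \<beta>)))" using \<beta> q by simp
        also have "\<dots> = \<beta> * (q powr (3 / 4) / q)" unfolding root ..
        also have "\<dots> = (w * (exp 1 * real n * p)) * (\<beta> * (q powr (3 / 4) / q))"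
          using x0 by (simp add: w_def q_def)
        also have "\<dots> = real n * y * (w * q powr (3 / 4))"
          using q by (simp add: y_def \<theta>_def)
        also have "\<dots> \<le> real n * y * q powr ((real k - 1) / 2)"
          using qx th \<beta> by (intro mult_left_mono) (simp_all add: y_def)
        finally show ?thesis .
      qed
      have mu_ge: "1 / (c * real k ^ s * b) \<le> \<mu>"
      proof -
        have "1 / (c * real k ^ s * b) = (1 / \<beta>) ^ k / (c * real k ^ s)"
          by (simp add: b_def power_one_over)
        also have "\<dots> \<le> (real n * y * q powr ((real k - 1) / 2)) ^ k / (c * real k ^ s)"
          using base \<beta> c by (intro divide_right_mono power_mono) simp_all
        also have "\<dots> \<le> \<mu>"
          unfolding \<mu>_def c_def y_def
          using k by (intro layered_mean_ge[OF q(1) th \<beta>(1) n big _ M dense]) simp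
        finally show ?thesis .
      qed
      have cb: "0 < c * real k ^ s * b" using c b k by simp
      have mu: "0 < \<mu>" using mu_ge cb by (meson divide_pos_pos less_le_trans zero_less_one)
      have far1: "far_ratio p n k (s + 1) \<le> 1"
        using far elim(2) unfolding b_def by linarith
      have "measure_pmf.prob (binomial_random_graph n p) {G. max_induced_forest_size G < k}
          \<le> real k * far_ratio p n k (s + 1) + (real k + 1) / \<mu>"
        using prob_max_induced_forest_less_le[OF p k(1) M(1) s far1 near, of \<mu>] mu
        by (simp add: \<mu>_def q_def \<theta>_def)
      also have "\<dots> \<le> real k * (Cf * real k ^ 2 * b) + (real k + 1) * (c * real k ^ s * b)"
      proof (intro add_mono mult_left_mono far)
        have "1 / \<mu> \<le> c * real k ^ s * b" using mu_ge mu cb by (simp add: field_simps)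
        then show "(real k + 1) / \<mu> \<le> (real k + 1) * (c * real k ^ s * b)"
          using mult_left_mono[of "1 / \<mu>" "c * real k ^ s * b" "real k + 1"] by simp
      qed simp
      also have "\<dots> = g k" by (simp add: g_def b_def)
      finally show "measure_pmf.prob (binomial_random_graph n p) {G. max_induced_forest_size G < k} \<le> g k" .
    qed
  qed
  moreover have "g \<longlonglongrightarrow> 0" unfolding g_def using \<beta> by real_asymp
  ultimately show ?thesis by blast
qed

text \<open>Each vertex beyond the threshold \<open>x + 3\<close> costs a factor \<open>(1 - p) powr (1 / 2)\<close> in the base of the
  first moment bound; half a vertex therefore makes it exponentially small.\<close>
lemma upper_tail:
  fixes p x :: real
  assumes p: "0 < p" "p < 1" and "0 < k" and x0: "(1 - p) powr (x / 2) * (exp 1 * real n * p) = 1"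
    and x: "x + 7 / 2 \<le> real k"
  shows "measure_pmf.prob (binomial_random_graph n p) {G. k \<le> max_induced_forest_size G}
    \<le> exp ((1 - p) / p) * ((1 - p) powr (1 / 4)) ^ k"
proof -
  define q where "q = 1 - p"
  have q: "0 < q" "q < 1" using p by (simp_all add: q_def)
  have "measure_pmf.prob (binomial_random_graph n p) {G. k \<le> max_induced_forest_size G}
      \<le> real (n choose k) * (q ^ (k choose 2) * (1 + real k * (p / q)) ^ k)"
    using first_moment_bound[OF p] by (simp add: q_def)
  also have "\<dots> \<le> exp (1 / (p / q)) * (exp 1 * real n * (p / q) * q powr ((real k - 1) / 2)) ^ k"
    using first_moment_estimate[of "p / q" q k n] p q assms(3) by simp
  also have "\<dots> \<le> exp (1 / (p / q)) * (q powr (1 / 4)) ^ k"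
  proof (intro mult_left_mono power_mono)
    have "q powr ((real k - 1) / 2) \<le> q powr (x / 2 + (1 + 1 / 4))"
      using q x by (intro powr_mono') (simp_all add: field_simps)
    also have "\<dots> = q powr (x / 2) * (q powr 1 * q powr (1 / 4))" by (simp only: powr_add)
    also have "q powr 1 = q" using q by simp
    finally have "q powr ((real k - 1) / 2) \<le> q powr (x / 2) * (q * q powr (1 / 4))" .
    then have "exp 1 * real n * (p / q) * q powr ((real k - 1) / 2)
        \<le> exp 1 * real n * (p / q) * (q powr (x / 2) * (q * q powr (1 / 4)))"
      using p q by (intro mult_left_mono) simp_all
    also have "\<dots> = (q powr (x / 2) * (exp 1 * real n * p)) * q powr (1 / 4)" using q by simp
    also have "\<dots> = q powr (1 / 4)" using x0 by (simp add: q_def)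
    finally show "exp 1 * real n * (p / q) * q powr ((real k - 1) / 2) \<le> q powr (1 / 4)" .
  qed (use p q in simp_all)
  finally show ?thesis by (simp add: q_def)
qed

text \<open>With \<open>\<epsilon> = 1 / 2\<close> the two values are \<open>k = \<lfloor>x + 5 / 2\<rfloor>\<close> and \<open>k + 1\<close>. Here \<open>k \<le> x + 5 / 2\<close> and
  \<open>k + 2 \<ge> x + 7 / 2\<close>, so the two tail bounds apply to the sizes \<open>k\<close> and \<open>k + 2\<close>.\<close>
theorem theorem2:
  fixes p :: real
  assumes "0 < p" and "p < 1"
  shows "\<exists>\<epsilon>::real. \<epsilon> > 0 \<and>
    with_high_probability (\<lambda>n. binomial_random_graph n p)
      (\<lambda>n G. int (max_induced_forest_size G)
                 = \<lfloor>2 * log (1 / (1 - p)) (exp 1 * real n * p) + 2 + \<epsilon>\<rfloor> \<or>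
              int (max_induced_forest_size G)
                 = \<lfloor>2 * log (1 / (1 - p)) (exp 1 * real n * p) + 3 + \<epsilon>\<rfloor>)"
proof (intro exI[of _ "1 / 2"] conjI)
  note p = assms
  define x where "x = (\<lambda>n. 2 * log (1 / (1 - p)) (exp 1 * real n * p))"
  \<comment> \<open>Only large \<open>n\<close> matter, for which the floor is positive.\<close>
  define K where "K = (\<lambda>n. nat \<lfloor>x n + 5 / 2\<rfloor>)"
  define P where "P = (\<lambda>n (G :: nat graph). int (max_induced_forest_size G) = \<lfloor>x n + 2 + 1 / 2\<rfloor> \<or>
    int (max_induced_forest_size G) = \<lfloor>x n + 3 + 1 / 2\<rfloor>)"
  define a where "a = (1 - p) powr (1 / 4)"
  let ?M = "\<lambda>n. binomial_random_graph n p"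
  have b: "1 < 1 / (1 - p)" using p by simp
  have a: "0 < a" "a < 1" using p powr_less_mono2[of "1 / 4" "1 - p" 1] by (simp_all add: a_def)
  have x0: "(1 - p) powr (x n / 2) * (exp 1 * real n * p) = 1" if "0 < n" for n
  proof -
    have pos: "0 < exp 1 * real n * p" using that p by simp
    have "(1 - p) powr (x n / 2) = inverse ((1 / (1 - p)) powr (x n / 2))"
      using p by (simp add: powr_divide)
    also have "(1 / (1 - p)) powr (x n / 2) = exp 1 * real n * p"
      unfolding x_def using powr_log_cancel[of "1 / (1 - p)", OF _ _ pos] b p by simp
    finally have "(1 - p) powr (x n / 2) = inverse (exp 1 * real n * p)" .
    then show ?thesis using left_inverse[of "exp 1 * real n * p"] pos by (simp only:)
  qed
  have "filterlim x at_top sequentially"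
  proof -
    have "0 < ln (1 / (1 - p))" using b by (intro ln_gt_zero) simp
    then show ?thesis unfolding x_def log_def using p by real_asymp
  qed
  then have x_large: "\<forall>\<^sub>F n in sequentially. C \<le> x n" for C by (simp add: filterlim_at_top)
  have K_lim: "filterlim K at_top sequentially"
    unfolding filterlim_at_top
  proof
    fix C :: nat
    show "\<forall>\<^sub>F n in sequentially. C \<le> K n"
      using x_large[of "real C"] by eventually_elim (simp add: K_def le_nat_iff le_floor_iff)
  qed
  obtain g where g: "g \<longlonglongrightarrow> 0" and lower: "\<forall>\<^sub>F k in sequentially. \<forall>n x.
    0 < n \<longrightarrow> (1 - p) powr (x / 2) * (exp 1 * real n * p) = 1 \<longrightarrow> x \<le> real k \<longrightarrow> real k \<le> x + 5 / 2 \<longrightarrow>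
    measure_pmf.prob (binomial_random_graph n p) {G. max_induced_forest_size G < k} \<le> g k"
    using lower_tail[OF p] by blast
  have lower': "\<forall>\<^sub>F n in sequentially. \<forall>m x.
    0 < m \<longrightarrow> (1 - p) powr (x / 2) * (exp 1 * real m * p) = 1 \<longrightarrow> x \<le> real (K n) \<longrightarrow> real (K n) \<le> x + 5 / 2 \<longrightarrow>
    measure_pmf.prob (binomial_random_graph m p) {G. max_induced_forest_size G < K n} \<le> g (K n)"
    using K_lim lower unfolding filterlim_iff by blast
  define h where "h = (\<lambda>k. g k + exp ((1 - p) / p) * a ^ (k + 2))"
  have fail: "\<forall>\<^sub>F n in sequentially. 1 - h (K n) \<le> measure_pmf.prob (?M n) {G. P n G}"
    using lower' x_large[of 0] eventually_gt_at_top[of 0]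
  proof eventually_elim
    case (elim n)
    let ?k = "K n"
    have fl: "int ?k = \<lfloor>x n + 5 / 2\<rfloor>" using elim(2) by (simp add: K_def)
    have k: "x n \<le> real ?k" "real ?k \<le> x n + 5 / 2" "x n + 7 / 2 \<le> real (?k + 2)"
      using fl by linarith+
    have fl': "\<lfloor>x n + 2 + 1 / 2\<rfloor> = int ?k" "\<lfloor>x n + 3 + 1 / 2\<rfloor> = int ?k + 1"
      using fl by linarith+
    have low: "measure_pmf.prob (?M n) {G. max_induced_forest_size G < ?k} \<le> g ?k"
      using elim(1,3) x0[OF elim(3)] k by blast
    have up: "measure_pmf.prob (?M n) {G. ?k + 2 \<le> max_induced_forest_size G}
        \<le> exp ((1 - p) / p) * a ^ (?k + 2)"
      unfolding a_def using upper_tail[OF p _ x0[OF elim(3)] k(3)] by simp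
    have "UNIV \<subseteq> {G. P n G} \<union> ({G. max_induced_forest_size G < ?k} \<union> {G. ?k + 2 \<le> max_induced_forest_size G})"
      unfolding P_def fl' by auto
    then have "measure_pmf.prob (?M n) UNIV \<le> measure_pmf.prob (?M n)
        ({G. P n G} \<union> ({G. max_induced_forest_size G < ?k} \<union> {G. ?k + 2 \<le> max_induced_forest_size G}))"
      by (intro measure_pmf.finite_measure_mono) simp_all
    also have "\<dots> \<le> measure_pmf.prob (?M n) {G. P n G}
        + measure_pmf.prob (?M n) ({G. max_induced_forest_size G < ?k} \<union> {G. ?k + 2 \<le> max_induced_forest_size G})"
      by (rule measure_Un_le) simp_all
    also have "\<dots> \<le> measure_pmf.prob (?M n) {G. P n G}
        + (measure_pmf.prob (?M n) {G. max_induced_forest_size G < ?k}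
          + measure_pmf.prob (?M n) {G. ?k + 2 \<le> max_induced_forest_size G})"
      by (intro add_left_mono measure_Un_le) simp_all
    finally have "1 \<le> measure_pmf.prob (?M n) {G. P n G}
        + (measure_pmf.prob (?M n) {G. max_induced_forest_size G < ?k}
          + measure_pmf.prob (?M n) {G. ?k + 2 \<le> max_induced_forest_size G})"
      by simp
    then show ?case using low up unfolding h_def by linarith
  qed
  have "(\<lambda>k. exp ((1 - p) / p) * a ^ (k + 2)) \<longlonglongrightarrow> 0" using a by real_asymp
  then have "h \<longlonglongrightarrow> 0" using tendsto_add[OF g] unfolding h_def by fastforce
  then have "(\<lambda>n. h (K n)) \<longlonglongrightarrow> 0" using K_lim by (rule filterlim_compose)
  then have "(\<lambda>n. 1 - h (K n)) \<longlonglongrightarrow> 1 - 0" by (intro tendsto_diff tendsto_const)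
  then have lim: "(\<lambda>n. 1 - h (K n)) \<longlonglongrightarrow> 1" by simp
  have "\<forall>\<^sub>F n in sequentially. measure_pmf.prob (?M n) {G. P n G} \<le> 1"
    by (intro always_eventually allI measure_pmf.prob_le_1)
  from tendsto_sandwich[OF fail this lim tendsto_const]
  have "(\<lambda>n. measure_pmf.prob (?M n) {G. P n G}) \<longlonglongrightarrow> 1" .
  then show "with_high_probability ?M
      (\<lambda>n G. int (max_induced_forest_size G)
                 = \<lfloor>2 * log (1 / (1 - p)) (exp 1 * real n * p) + 2 + 1 / 2\<rfloor> \<or>
              int (max_induced_forest_size G)
                 = \<lfloor>2 * log (1 / (1 - p)) (exp 1 * real n * p) + 3 + 1 / 2\<rfloor>)"
    by (simp only: with_high_probability_def P_def x_def)
qed simp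

end
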